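(* Let $\omega$ be an open strict interval of $\mathbb T$ and let $T>0$. If $f_0 \in \mathcal{NC}_{H^2}(\omega,T)$, then $f_0$ can be extended holomorphically to $\widehat{\mathbb C}\setminus \overline\omega$. Denoting this extension also by $f_0$, we have (i) $f_0(\infty) = 0$; (ii) $\int_{|z|>1} |f_0'(z)|^2 \,dA(z) <+\infty$.
   Context: $\mathbb T$ is the complex unit circle, identified with $\mathbb R/2\pi\mathbb Z$ via $x\mapsto e^{ix}$. An open strict interval of $\mathbb T$ is an open arc $\{e^{ix}:a<x<b\}$ with $0<b-a<2\pi$; $\overline\omega$ is its topological closure. $\widehat{\mathbb C}=\mathbb C\cup\{\infty\}$ is the Riemann sphere, $\mathbb D$ the open unit disk, $dA$ planar Lebesgue measure. Functions are complex valued; $f\in L^2(\mathbb T)$ is written $f(e^{ix})=\sum_{n\in\mathbb Z}\widehat f(n)e^{inx}$. The Riesz projector is $P_+f(e^{ix})=\sum_{n\ge 0}\widehat f(n)e^{inx}$, and $H^2=P_+L^2(\mathbb T)$; an element $f\in H^2$ is identified with the holomorphic function $f(z)=\sum_{n\ge0}\widehat f(n)z^n$ on $\mathbb D$ (Hardy space), and it is this function on $\mathbb D$ that is extended. Let $S(t)f(e^{ix})=\sum_{n}\widehat f(n)e^{-|n|t}e^{inx}$ (the semigroup generated by $-|D|$, $|D|f=\sum_n|n|\widehat f(n)e^{inx}$). The $H^2$ control system is $(\partial_t+|D|)f(t,e^{ix})=P_+\mathbf 1_\omega u(t,e^{ix})$, $f(0,\cdot)=f_0\in H^2$, with control $u\in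 L^2([0,T]\times\omega)$; its solution satisfies $f(T,\cdot)=S(T)f_0+\int_0^TS(T-s)P_+(\mathbf 1_\omega u(s,\cdot))\,ds$, where $\mathbf 1_\omega u$ denotes the extension of $u$ by $0$ outside $\omega$. $\mathcal{NC}_{H^2}(\omega,T)$ is the set of $f_0\in H^2$ for which there is $u\in L^2([0,T]\times\omega)$ with $f(T,\cdot)=0$. (This set does not depend on $T>0$.) *)

theory Defs
  imports "HOL-Complex_Analysis.Complex_Analysis"
begin

section \<open>The Hilbert space of square-integrable functions on the circle\<close>

text \<open>Arc length on the unit circle, as a measure on the Borel sets of the plane.\<close>

definition circle_measure :: "complex measure" where
  "circle_measure = distr (restrict_space lborel {0..<2 * pi}) borel cis"

lemma sets_circle_measure [simp, measurable_cong]: "sets circle_measure = sets borel"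
  by (simp add: circle_measure_def)

lemma space_circle_measure [simp]: "space circle_measure = UNIV"
  by (simp add: circle_measure_def)

lemma measurable_cis_circle [measurable]: "cis \<in> restrict_space lborel {0..<2 * pi} \<rightarrow>\<^sub>M borel"
proof -
  have "continuous_on UNIV cis" by (intro continuous_intros)
  then have "cis \<in> borel_measurable borel"
    by (rule borel_measurable_continuous_onI)
  then have "cis \<in> borel_measurable lborel" by simp
  then show ?thesis by (rule measurable_restrict_space1)
qed

interpretation circle: finite_measure circle_measure
proof
  have "emeasure circle_measure (space circle_measure)
      = emeasure (restrict_space lborel {0..<2 * pi}) (space (restrict_space lborel {0..<2 * pi}))"
    unfolding circle_measure_def by (subst emeasure_distr) (auto simp: space_restrict_space)
  also have "\<dots> = ennreal (2 * pi)"
    by (subst emeasure_restrict_space) (auto simp: space_restrict_space)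
  finally show "emeasure circle_measure (space circle_measure) \<noteq> \<infinity>" by simp
qed

definition square_integrable :: "(complex \<Rightarrow> complex) \<Rightarrow> bool" where
  "square_integrable f \<longleftrightarrow>
     f \<in> borel_measurable circle_measure \<and> integrable circle_measure (\<lambda>z. (norm (f z))\<^sup>2)"

lemma square_integrable_measurable [measurable_dest]:
  "square_integrable f \<Longrightarrow> f \<in> borel_measurable circle_measure"
  by (simp add: square_integrable_def)

lemma square_integrable_zero: "square_integrable (\<lambda>_. 0)"
  by (simp add: square_integrable_def)

lemma square_integrable_mono:
  assumes "square_integrable f" "g \<in> borel_measurable circle_measure"
    and "\<And>z. norm (g z) \<le> c * norm (f z)"
  shows "square_integrable g"
proof -
  have "integrable circle_measure (\<lambda>z. c\<^sup>2 * (norm (f z))\<^sup>2)"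
    using assms(1) by (simp add: square_integrable_def)
  then have "integrable circle_measure (\<lambda>z. (norm (g z))\<^sup>2)"
  proof (rule Bochner_Integration.integrable_bound)
    show "(\<lambda>z. (norm (g z))\<^sup>2) \<in> borel_measurable circle_measure" using assms(2) by simp
    have "(norm (g z))\<^sup>2 \<le> c\<^sup>2 * (norm (f z))\<^sup>2" for z
      using power_mono[OF assms(3)[of z], of 2] by (simp add: power_mult_distrib)
    then show "AE z in circle_measure. norm ((norm (g z))\<^sup>2) \<le> norm (c\<^sup>2 * (norm (f z))\<^sup>2)"
      by (simp add: abs_mult)
  qed
  with assms(2) show ?thesis by (simp add: square_integrable_def)
qed

lemma norm_add_square_le: "(norm (a + b))\<^sup>2 \<le> 2 * (norm a)\<^sup>2 + 2 * (norm (b::complex))\<^sup>2"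
proof -
  have "(norm (a + b))\<^sup>2 \<le> (norm a + norm b)\<^sup>2"
    by (intro power_mono norm_triangle_ineq norm_ge_zero)
  also have "\<dots> \<le> 2 * (norm a)\<^sup>2 + 2 * (norm b)\<^sup>2"
    using zero_le_power2[of "norm a - norm b"] by (simp add: power2_eq_square algebra_simps)
  finally show ?thesis .
qed

lemma square_integrable_add:
  assumes "square_integrable f" "square_integrable g"
  shows "square_integrable (\<lambda>z. f z + g z)"
proof -
  have [measurable]: "f \<in> borel_measurable circle_measure" "g \<in> borel_measurable circle_measure"
    using assms by (auto simp: square_integrable_def)
  have "integrable circle_measure (\<lambda>z. 2 * (norm (f z))\<^sup>2 + 2 * (norm (g z))\<^sup>2)"
    using assms by (simp add: square_integrable_def)
  then have "integrable circle_measure (\<lambda>z. (norm (f z + g z))\<^sup>2)"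
    by (rule Bochner_Integration.integrable_bound) (auto intro: order_trans[OF norm_add_square_le])
  then show ?thesis by (simp add: square_integrable_def)
qed

lemma square_integrable_cmult: "square_integrable f \<Longrightarrow> square_integrable (\<lambda>z. c * f z)"
  by (rule square_integrable_mono[where c = "norm c" and f = f]) (auto simp: norm_mult square_integrable_def)

lemma square_integrable_scaleR: "square_integrable f \<Longrightarrow> square_integrable (\<lambda>z. c *\<^sub>R f z)"
  by (rule square_integrable_mono[where c = "\<bar>c\<bar>" and f = f]) (auto simp: square_integrable_def)

lemma square_integrable_uminus: "square_integrable f \<Longrightarrow> square_integrable (\<lambda>z. - f z)"
  by (rule square_integrable_mono[where c = 1 and f = f]) (auto simp: square_integrable_def)

lemma square_integrable_diff:
  "square_integrable f \<Longrightarrow> square_integrable g \<Longrightarrow> square_integrable (\<lambda>z. f z - g z)"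
  using square_integrable_add[of f "\<lambda>z. - g z"] square_integrable_uminus[of g] by simp

lemma integrable_inner_square_integrable:
  assumes "square_integrable f" "square_integrable g"
  shows "integrable circle_measure (\<lambda>z. inner (f z) (g z))"
proof -
  have [measurable]: "f \<in> borel_measurable circle_measure" "g \<in> borel_measurable circle_measure"
    using assms by (auto simp: square_integrable_def)
  have "integrable circle_measure (\<lambda>z. (norm (f z))\<^sup>2 + (norm (g z))\<^sup>2)"
    using assms by (simp add: square_integrable_def)
  then show ?thesis
  proof (rule Bochner_Integration.integrable_bound)
    have "\<bar>inner a b\<bar> \<le> (norm a)\<^sup>2 + (norm b)\<^sup>2" for a b :: complex
    proof -
      have "\<bar>inner a b\<bar> \<le> norm a * norm b" by (rule Cauchy_Schwarz_ineq2)
      also have "\<dots> \<le> (norm a)\<^sup>2 + (norm b)\<^sup>2"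
        using sum_squares_bound[of "norm a" "norm b"] mult_nonneg_nonneg[OF norm_ge_zero[of a] norm_ge_zero[of b]]
        by (simp only: power2_eq_square mult.assoc)
      finally show ?thesis .
    qed
    then show "AE z in circle_measure. norm (inner (f z) (g z)) \<le> norm ((norm (f z))\<^sup>2 + (norm (g z))\<^sup>2)"
      by simp
  qed auto
qed

quotient_type circle_L2 = "complex \<Rightarrow> complex" / partial:
  "\<lambda>f g. square_integrable f \<and> square_integrable g \<and> (AE z in circle_measure. f z = g z)"
proof (rule part_equivpI)
  show "\<exists>x. square_integrable x \<and> square_integrable x \<and> (AE z in circle_measure. x z = x z)"
    using square_integrable_zero by auto
  show "symp (\<lambda>f g. square_integrable f \<and> square_integrable g \<and> (AE z in circle_measure. f z = g z))"
    by (rule sympI) (auto simp: eq_commute)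
  show "transp (\<lambda>f g. square_integrable f \<and> square_integrable g \<and> (AE z in circle_measure. f z = g z))"
    by (rule transpI) (auto elim: AE_mp)
qed

instantiation circle_L2 :: real_vector
begin

lift_definition zero_circle_L2 :: circle_L2 is "\<lambda>_. 0"
  by (simp add: square_integrable_zero)

lift_definition plus_circle_L2 :: "circle_L2 \<Rightarrow> circle_L2 \<Rightarrow> circle_L2" is "\<lambda>f g z. f z + g z"
  by (auto intro: square_integrable_add elim: AE_mp)

lift_definition minus_circle_L2 :: "circle_L2 \<Rightarrow> circle_L2 \<Rightarrow> circle_L2" is "\<lambda>f g z. f z - g z"
  by (auto intro: square_integrable_diff elim: AE_mp)

lift_definition uminus_circle_L2 :: "circle_L2 \<Rightarrow> circle_L2" is "\<lambda>f z. - f z"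
  by (auto intro: square_integrable_uminus)

lift_definition scaleR_circle_L2 :: "real \<Rightarrow> circle_L2 \<Rightarrow> circle_L2" is "\<lambda>c f z. c *\<^sub>R f z"
  by (auto intro: square_integrable_scaleR)

instance
proof
  fix f g h :: circle_L2 and a b :: real
  show "f + g + h = f + (g + h)"
    by transfer (auto intro!: square_integrable_add simp: add.assoc)
  show "f + g = g + f" 
    by transfer (auto intro!: square_integrable_add simp: add.commute)
  show "0 + f = f" by transfer auto
  show "- f + f = 0" by transfer (auto simp: square_integrable_zero)
  show "f - g = f + - g"
    by transfer (auto intro!: square_integrable_add square_integrable_diff square_integrable_uminus)
  show "a *\<^sub>R (f + g) = a *\<^sub>R f + a *\<^sub>R g"
    by transfer (auto intro!: square_integrable_add square_integrable_scaleR simp: scaleR_add_right)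
  show "(a + b) *\<^sub>R f = a *\<^sub>R f + b *\<^sub>R f"
    by transfer (auto intro!: square_integrable_add square_integrable_scaleR simp: scaleR_add_left 
        simp del: scaleR_conv_of_real)
  show "a *\<^sub>R b *\<^sub>R f = (a * b) *\<^sub>R f"
    by transfer (auto intro!: square_integrable_scaleR)
  show "1 *\<^sub>R f = f" by transfer auto
qed

end

text \<open>The inner product below is the real part of the usual complex one; it induces the same norm.\<close>

instantiation circle_L2 :: real_inner
begin

lift_definition inner_circle_L2 :: "circle_L2 \<Rightarrow> circle_L2 \<Rightarrow> real"
  is "\<lambda>f g. integral\<^sup>L circle_measure (\<lambda>z. inner (f z) (g z))"
proof -
  fix f f' g g' :: "complex \<Rightarrow> complex"
  assume *: "square_integrable f \<and> square_integrable f' \<and> (AE z in circle_measure. f z = f' z)"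
    "square_integrable g \<and> square_integrable g' \<and> (AE z in circle_measure. g z = g' z)"
  then have [measurable]: "f \<in> borel_measurable circle_measure" "g \<in> borel_measurable circle_measure"
    "f' \<in> borel_measurable circle_measure" "g' \<in> borel_measurable circle_measure"
    by (auto simp: square_integrable_def)
  show "integral\<^sup>L circle_measure (\<lambda>z. inner (f z) (g z)) = integral\<^sup>L circle_measure (\<lambda>z. inner (f' z) (g' z))"
    using * by (intro integral_cong_AE) (auto elim: AE_mp)
qed

definition norm_circle_L2 :: "circle_L2 \<Rightarrow> real" where
  "norm_circle_L2 f = sqrt (inner f f)"

definition sgn_circle_L2 :: "circle_L2 \<Rightarrow> circle_L2" where
  "sgn_circle_L2 f = f /\<^sub>R norm f"

definition dist_circle_L2 :: "circle_L2 \<Rightarrow> circle_L2 \<Rightarrow> real" where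
  "dist_circle_L2 f g = norm (f - g)"

definition uniformity_circle_L2 :: "(circle_L2 \<times> circle_L2) filter" where
  "uniformity_circle_L2 = (INF e\<in>{0<..}. principal {(x, y). dist x y < e})"

definition open_circle_L2 :: "circle_L2 set \<Rightarrow> bool" where
  "open_circle_L2 U \<longleftrightarrow> (\<forall>x\<in>U. \<forall>\<^sub>F (x', y) in uniformity. x' = x \<longrightarrow> y \<in> U)"

instance
proof
  fix f g h :: circle_L2 and a :: real
  show "sgn f = inverse (norm f) *\<^sub>R f" by (simp add: sgn_circle_L2_def)
  show "dist f g = norm (f - g)" by (rule dist_circle_L2_def)
  show "(uniformity :: (circle_L2 \<times> circle_L2) filter) = (INF e\<in>{0<..}. principal {(x, y). dist x y < e})"
    by (rule uniformity_circle_L2_def)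
  show "open U = (\<forall>x\<in>U. \<forall>\<^sub>F (x', y) in uniformity. x' = x \<longrightarrow> y \<in> U)" for U :: "circle_L2 set"
    by (rule open_circle_L2_def)
  show "inner f g = inner g f" by transfer (simp add: inner_commute)
  show "inner (f + g) h = inner f h + inner g h"
    by transfer (simp add: inner_add_left integrable_inner_square_integrable)
  show "inner (a *\<^sub>R f) g = a * inner f g"
    by transfer simp
  show "0 \<le> inner f f" by transfer simp
  show "inner f f = 0 \<longleftrightarrow> f = 0"
  proof transfer
    fix f :: "complex \<Rightarrow> complex"
    assume "square_integrable f \<and> square_integrable f \<and> (AE z in circle_measure. f z = f z)"
    then have f: "square_integrable f" by simp
    then have "integral\<^sup>L circle_measure (\<lambda>z. inner (f z) (f z)) = 0 \<longleftrightarrow>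
        (AE z in circle_measure. inner (f z) (f z) = 0)"
      by (intro integral_nonneg_eq_0_iff_AE integrable_inner_square_integrable) auto
    with f show "(integral\<^sup>L circle_measure (\<lambda>z. inner (f z) (f z)) = 0) = (square_integrable f \<and>
        square_integrable (\<lambda>_. 0) \<and> (AE z in circle_measure. f z = 0))"
      by (simp add: square_integrable_zero)
  qed
  show "norm f = sqrt (inner f f)" by (rule norm_circle_L2_def)
qed

end

text \<open>The class of a square-integrable function; \<open>0\<close> if the function is not square-integrable.\<close>

definition to_L2 :: "(complex \<Rightarrow> complex) \<Rightarrow> circle_L2" where
  "to_L2 f = (if square_integrable f then abs_circle_L2 f else 0)"

lemma square_integrable_rep: "square_integrable (rep_circle_L2 x)"
  using Quotient3_rep_reflp[OF Quotient3_circle_L2] by auto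

lemma to_L2_rep [simp]: "to_L2 (rep_circle_L2 x) = x"
  by (simp add: to_L2_def square_integrable_rep Quotient3_abs_rep[OF Quotient3_circle_L2])

lemma to_L2_eq_iff:
  assumes "square_integrable f" "square_integrable g"
  shows "to_L2 f = to_L2 g \<longleftrightarrow> (AE z in circle_measure. f z = g z)"
  using assms Quotient3_rel[OF Quotient3_circle_L2, of f g] by (auto simp: to_L2_def)

lemma to_L2_add:
  "square_integrable f \<Longrightarrow> square_integrable g \<Longrightarrow> to_L2 (\<lambda>z. f z + g z) = to_L2 f + to_L2 g"
  by (simp add: to_L2_def square_integrable_add plus_circle_L2.abs_eq)

lemma to_L2_diff:
  "square_integrable f \<Longrightarrow> square_integrable g \<Longrightarrow> to_L2 (\<lambda>z. f z - g z) = to_L2 f - to_L2 g"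
  by (simp add: to_L2_def square_integrable_diff minus_circle_L2.abs_eq)

lemma to_L2_scaleR: "square_integrable f \<Longrightarrow> to_L2 (\<lambda>z. c *\<^sub>R f z) = c *\<^sub>R to_L2 f"
  unfolding to_L2_def by (simp add: square_integrable_scaleR scaleR_circle_L2.abs_eq del: scaleR_conv_of_real)

lemma to_L2_zero [simp]: "to_L2 (\<lambda>_. 0) = 0"
  by (simp add: to_L2_def zero_circle_L2_def)

lemma inner_to_L2:
  "square_integrable f \<Longrightarrow> square_integrable g \<Longrightarrow>
     inner (to_L2 f) (to_L2 g) = integral\<^sup>L circle_measure (\<lambda>z. inner (f z) (g z))"
  by (simp add: to_L2_def inner_circle_L2.abs_eq)

lemma norm_to_L2:
  "square_integrable f \<Longrightarrow> (norm (to_L2 f))\<^sup>2 = integral\<^sup>L circle_measure (\<lambda>z. (norm (f z))\<^sup>2)"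
  by (simp add: power2_norm_eq_inner inner_to_L2)

lemma nn_integral_square_integrable:
  "square_integrable f \<Longrightarrow>
     (\<integral>\<^sup>+z. ennreal ((norm (f z))\<^sup>2) \<partial>circle_measure) = ennreal ((norm (to_L2 f))\<^sup>2)"
  by (subst nn_integral_eq_integral) (auto simp: norm_to_L2 square_integrable_def)

lemma square_integrable_nnI:
  assumes "f \<in> borel_measurable circle_measure"
    and "(\<integral>\<^sup>+z. ennreal ((norm (f z))\<^sup>2) \<partial>circle_measure) < \<infinity>"
  shows "square_integrable f"
  using assms by (auto simp: square_integrable_def intro!: integrableI_bounded)

lemma square_integrable_const: "square_integrable (\<lambda>_. c)"
  by (simp add: square_integrable_def)

lemma nn_integral_norm_le:
  assumes "square_integrable f"
  shows "(\<integral>\<^sup>+z. ennreal (norm (f z)) \<partial>circle_measure) \<le> ennreal (norm (to_L2 (\<lambda>_. 1)) * norm (to_L2 f))"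
proof -
  have [measurable]: "f \<in> borel_measurable circle_measure"
    using assms by (simp add: square_integrable_def)
  let ?g = "\<lambda>z. complex_of_real (norm (f z))"
  have g: "square_integrable ?g"
    by (rule square_integrable_mono[OF assms, where c = 1]) auto
  have int: "integrable circle_measure (\<lambda>z. norm (f z))"
    using integrable_inner_square_integrable[OF g square_integrable_const[of 1]] by simp
  have "integral\<^sup>L circle_measure (\<lambda>z. norm (f z)) = inner (to_L2 ?g) (to_L2 (\<lambda>_. 1))"
    by (subst inner_to_L2[OF g square_integrable_const[of 1]]) simp
  also have "\<dots> \<le> norm (to_L2 ?g) * norm (to_L2 (\<lambda>_. 1))" by (rule norm_cauchy_schwarz)
  also have "norm (to_L2 ?g) = norm (to_L2 f)"
    using norm_to_L2[OF g] norm_to_L2[OF assms] by (intro power2_eq_iff_nonneg[THEN iffD1, OF norm_ge_zero norm_ge_zero]) simp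
  finally show ?thesis
    using int by (subst nn_integral_eq_integral) (auto simp: mult.commute)
qed

text \<open>Riesz--Fischer: an almost everywhere convergent subsequence and Fatou's lemma.\<close>

instance circle_L2 :: banach
proof
  fix X :: "nat \<Rightarrow> circle_L2"
  assume "Cauchy X"
  then have "\<exists>N. \<forall>m\<ge>N. \<forall>n\<ge>N. norm (X m - X n) < (1/2)^k" for k :: nat
    using CauchyD[of X "(1/2)^k"] by simp
  then obtain N where N: "\<And>k m n. m \<ge> N k \<Longrightarrow> n \<ge> N k \<Longrightarrow> norm (X m - X n) < (1/2)^k"
    by metis
  define r where "r k = (\<Sum>i\<le>k. N i)" for k
  have rN: "r m \<ge> N k" if "k \<le> m" for k m
    unfolding r_def using that by (intro member_le_sum) auto
  define f where "f k = rep_circle_L2 (X (r k))" for k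
  have f: "square_integrable (f k)" and Xf: "X (r k) = to_L2 (f k)" for k
    by (simp_all add: f_def square_integrable_rep)
  have [measurable]: "f k \<in> borel_measurable circle_measure" for k
    using f by (simp add: square_integrable_def)
  have diff: "square_integrable (\<lambda>z. f m z - f k z)"
    and normdiff: "norm (to_L2 (\<lambda>z. f m z - f k z)) = norm (X (r m) - X (r k))" for m k
    using f by (simp_all add: square_integrable_diff to_L2_diff Xf)
  define C where "C = norm (to_L2 (\<lambda>_. 1))"
  have "(\<integral>\<^sup>+z. (\<Sum>k. ennreal (norm (f (Suc k) z - f k z))) \<partial>circle_measure)
      = (\<Sum>k. \<integral>\<^sup>+z. ennreal (norm (f (Suc k) z - f k z)) \<partial>circle_measure)"
    by (rule nn_integral_suminf) simp
  also have "\<dots> \<le> (\<Sum>k. ennreal (C * (1/2)^k))"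
  proof (intro suminf_le)
    fix k
    have "(\<integral>\<^sup>+z. ennreal (norm (f (Suc k) z - f k z)) \<partial>circle_measure)
        \<le> ennreal (C * norm (X (r (Suc k)) - X (r k)))"
      using nn_integral_norm_le[OF diff[of "Suc k" k]] by (simp add: normdiff C_def)
    also have "\<dots> \<le> ennreal (C * (1/2)^k)"
      using N[of k "r (Suc k)" "r k"] rN[of k "Suc k"] rN[of k k]
      by (intro ennreal_leI mult_left_mono) (auto simp: C_def)
    finally show "(\<integral>\<^sup>+z. ennreal (norm (f (Suc k) z - f k z)) \<partial>circle_measure) \<le> ennreal (C * (1/2)^k)" .
  qed (rule summableI)+
  also have "\<dots> = ennreal (\<Sum>k. C * (1/2)^k)"
  proof (rule suminf_ennreal2)
    show "summable (\<lambda>k. C * (1/2)^k)" by (intro summable_mult summable_geometric) simp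
  qed (simp add: C_def)
  also have "\<dots> < \<infinity>" by simp
  finally have "(\<integral>\<^sup>+z. (\<Sum>k. ennreal (norm (f (Suc k) z - f k z))) \<partial>circle_measure) \<noteq> \<infinity>"
    by (rule less_imp_neq)
  then have "AE z in circle_measure. (\<Sum>k. ennreal (norm (f (Suc k) z - f k z))) \<noteq> \<infinity>"
    by (intro nn_integral_PInf_AE) auto
  then have conv: "AE z in circle_measure. (\<lambda>k. f k z) \<longlonglongrightarrow> lim (\<lambda>k. f k z)"
  proof eventually_elim
    fix z assume "(\<Sum>k. ennreal (norm (f (Suc k) z - f k z))) \<noteq> \<infinity>"
    then have "summable (\<lambda>k. norm (f (Suc k) z - f k z))"
      by (intro summable_suminf_not_top) auto
    then have "summable (\<lambda>k. f (Suc k) z - f k z)" by (rule summable_norm_cancel)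
    then have "convergent (\<lambda>n. \<Sum>k<n. f (Suc k) z - f k z)"
      by (simp add: summable_iff_convergent)
    then have "convergent (\<lambda>n. (f n z - f 0 z) + f 0 z)"
      by (intro convergent_add convergent_const) (simp add: sum_lessThan_telescope[of "\<lambda>k. f k z"])
    then have "convergent (\<lambda>n. f n z)" by simp
    then show "(\<lambda>k. f k z) \<longlonglongrightarrow> lim (\<lambda>k. f k z)"
      by (rule convergent_LIMSEQ_iff[THEN iffD1])
  qed
  define F where "F z = lim (\<lambda>k. f k z)" for z
  have [measurable]: "F \<in> borel_measurable circle_measure"
    unfolding F_def by (rule borel_measurable_lim_metric) simp
  have bound: "(\<integral>\<^sup>+z. ennreal ((norm (F z - f k z))\<^sup>2) \<partial>circle_measure) \<le> ennreal (((1/2)^k)\<^sup>2)" for k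
  proof -
    have "(\<integral>\<^sup>+z. ennreal ((norm (F z - f k z))\<^sup>2) \<partial>circle_measure)
        = (\<integral>\<^sup>+z. liminf (\<lambda>m. ennreal ((norm (f m z - f k z))\<^sup>2)) \<partial>circle_measure)"
    proof (rule nn_integral_cong_AE)
      show "AE z in circle_measure. ennreal ((norm (F z - f k z))\<^sup>2)
          = liminf (\<lambda>m. ennreal ((norm (f m z - f k z))\<^sup>2))"
        using conv
      proof eventually_elim
        fix z assume "(\<lambda>k. f k z) \<longlonglongrightarrow> lim (\<lambda>k. f k z)"
        then have "(\<lambda>m. ennreal ((norm (f m z - f k z))\<^sup>2)) \<longlonglongrightarrow> ennreal ((norm (F z - f k z))\<^sup>2)"
          unfolding F_def by (intro tendsto_intros tendsto_ennrealI)
        then show "ennreal ((norm (F z - f k z))\<^sup>2) = liminf (\<lambda>m. ennreal ((norm (f m z - f k z))\<^sup>2))"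
          by (rule lim_imp_Liminf[OF trivial_limit_sequentially, symmetric])
      qed
    qed
    also have "\<dots> \<le> liminf (\<lambda>m. \<integral>\<^sup>+z. ennreal ((norm (f m z - f k z))\<^sup>2) \<partial>circle_measure)"
      by (rule nn_integral_liminf) simp
    also have "\<dots> \<le> ennreal (((1/2)^k)\<^sup>2)"
    proof (rule Liminf_le[OF trivial_limit_sequentially], rule eventually_sequentiallyI[of k])
      fix m assume "k \<le> m"
      then have "norm (X (r m) - X (r k)) \<le> (1/2)^k"
        using N[of k "r m" "r k"] rN[of k m] rN[of k k] by simp
      then have "ennreal ((norm (X (r m) - X (r k)))\<^sup>2) \<le> ennreal (((1/2)^k)\<^sup>2)"
        by (intro ennreal_leI power_mono) auto
      then show "(\<integral>\<^sup>+z. ennreal ((norm (f m z - f k z))\<^sup>2) \<partial>circle_measure) \<le> ennreal (((1/2)^k)\<^sup>2)"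
        by (simp only: nn_integral_square_integrable[OF diff] normdiff)
    qed
    finally show ?thesis .
  qed
  have Ff: "square_integrable (\<lambda>z. F z - f k z)" for k
    using le_less_trans[OF bound[of k] ennreal_less_top] by (intro square_integrable_nnI) simp_all
  have F: "square_integrable F"
    using square_integrable_add[OF Ff[of 0] f[of 0]] by simp
  have lim: "norm (to_L2 F - X (r k)) \<le> (1/2)^k" for k
  proof -
    have "ennreal ((norm (to_L2 F - X (r k)))\<^sup>2) \<le> ennreal (((1/2)^k)\<^sup>2)"
      using bound[of k] unfolding nn_integral_square_integrable[OF Ff[of k]] to_L2_diff[OF F f] Xf .
    then have "(norm (to_L2 F - X (r k)))\<^sup>2 \<le> ((1/2)^k)\<^sup>2"
      by (subst (asm) ennreal_le_iff) simp_all
    then show ?thesis by (rule power2_le_imp_le) simp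
  qed
  have "X \<longlonglongrightarrow> to_L2 F"
  proof (rule LIMSEQ_I)
    fix e :: real assume "0 < e"
    then obtain k where k: "(1/2::real)^k < e / 2"
      using real_arch_pow_inv[of "e/2" "1/2"] by auto
    have "norm (X m - to_L2 F) < e" if "m \<ge> N k" for m
    proof -
      have "norm (X m - X (r k)) < (1/2)^k" using N[of k m "r k"] rN[of k k] that by simp
      moreover have "norm (X (r k) - to_L2 F) \<le> (1/2)^k" using lim[of k] by (simp add: norm_minus_commute)
      moreover have "norm (X m - to_L2 F) \<le> norm (X m - X (r k)) + norm (X (r k) - to_L2 F)"
        using norm_triangle_ineq[of "X m - X (r k)" "X (r k) - to_L2 F"] by simp
      ultimately show ?thesis using k by linarith
    qed
    then show "\<exists>no. \<forall>n\<ge>no. norm (X n - to_L2 F) < e" by blast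
  qed
  then show "convergent X" by (rule convergentI)
qed

lemma ex_countable_rational_span:
  fixes B :: "'a::real_normed_vector set"
  assumes "countable B"
  obtains D where "countable D" "B \<subseteq> closure D" "subspace (closure D)"
proof -
  define comb where "comb xs = (\<Sum>(q, b)\<leftarrow>xs. real_of_rat q *\<^sub>R b)" for xs :: "(rat \<times> 'a) list"
  define D where "D = comb ` lists (UNIV \<times> B)"
  have "countable D"
    unfolding D_def using assms by (intro countable_image countable_lists countable_SIGMA) auto
  have D_add: "x + y \<in> D" if xy: "x \<in> D" "y \<in> D" for x y
  proof -
    obtain xs where "xs \<in> lists (UNIV \<times> B)" "x = comb xs"
      using xy(1) unfolding D_def by blast
    moreover obtain ys where "ys \<in> lists (UNIV \<times> B)" "y = comb ys"
      using xy(2) unfolding D_def by blast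
    ultimately have "xs @ ys \<in> lists (UNIV \<times> B)" "x + y = comb (xs @ ys)"
      by (auto simp: comb_def)
    then show ?thesis unfolding D_def by blast
  qed
  have D_scale: "real_of_rat q *\<^sub>R x \<in> D" if xy: "x \<in> D" for q x
  proof -
    obtain xs where xs: "xs \<in> lists (UNIV \<times> B)" "x = comb xs"
      using xy unfolding D_def by blast
    have "real_of_rat q *\<^sub>R comb xs = comb (map (\<lambda>(p, b). (q * p, b)) xs)"
      unfolding comb_def by (induction xs) (auto simp: of_rat_mult scaleR_add_right)
    moreover have "map (\<lambda>(p, b). (q * p, b)) xs \<in> lists (UNIV \<times> B)"
      using xs(1) by auto
    ultimately show ?thesis unfolding D_def xs(2) by blast
  qed
  have zero: "0 \<in> D"
    unfolding D_def by (rule image_eqI[of _ _ "[]"]) (auto simp: comb_def)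
  have "B \<subseteq> D"
  proof
    fix b assume "b \<in> B"
    then show "b \<in> D"
      unfolding D_def by (intro image_eqI[of _ _ "[(1, b)]"]) (auto simp: comb_def)
  qed
  then have "B \<subseteq> closure D" using closure_subset by blast
  have "subspace (closure D)"
  proof (rule subspaceI)
    show "0 \<in> closure D" using zero closure_subset by blast
  next
    fix x y assume "x \<in> closure D" "y \<in> closure D"
    then obtain f g where "\<And>n. f n \<in> D" "f \<longlonglongrightarrow> x" "\<And>n. g n \<in> D" "g \<longlonglongrightarrow> y"
      unfolding closure_sequential by blast
    then have "\<And>n. f n + g n \<in> D" "(\<lambda>n. f n + g n) \<longlonglongrightarrow> x + y"
      by (auto intro: D_add tendsto_add)
    then show "x + y \<in> closure D"
      unfolding closure_sequential by (intro exI[of _ "\<lambda>n. f n + g n"]) auto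
  next
    fix c :: real and x assume "x \<in> closure D"
    then obtain f where f: "\<And>n. f n \<in> D" "f \<longlonglongrightarrow> x"
      unfolding closure_sequential by blast
    have "\<exists>q. c < real_of_rat q \<and> real_of_rat q < c + 1 / real (Suc n)" for n
      by (rule of_rat_dense) simp
    then obtain q where q: "\<And>n. c < real_of_rat (q n)" "\<And>n. real_of_rat (q n) < c + 1 / real (Suc n)"
      by metis
    have "(\<lambda>n. real_of_rat (q n)) \<longlonglongrightarrow> c"
    proof (rule tendsto_sandwich[of "\<lambda>_. c" _ _ "\<lambda>n. c + 1 / real (Suc n)"])
      show "(\<lambda>n. c + 1 / real (Suc n)) \<longlonglongrightarrow> c"
        using tendsto_add[OF tendsto_const[of c] LIMSEQ_inverse_real_of_nat]
        by (simp add: inverse_eq_divide)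
    qed (use q in \<open>simp_all add: less_imp_le\<close>)
    with f have "(\<lambda>n. real_of_rat (q n) *\<^sub>R f n) \<longlonglongrightarrow> c *\<^sub>R x" by (intro tendsto_scaleR)
    then show "c *\<^sub>R x \<in> closure D"
      unfolding closure_sequential using D_scale[OF f(1)]
      by (intro exI[of _ "\<lambda>n. real_of_rat (q n) *\<^sub>R f n"]) auto
  qed
  with \<open>countable D\<close> \<open>B \<subseteq> closure D\<close> show thesis by (rule that)
qed

lemma second_countable_if_separable:
  fixes D :: "'a::metric_space set"
  assumes "countable D" "closure D = UNIV"
  shows "\<exists>B::'a set set. countable B \<and> open = generate_topology B"
proof -
  define B where "B = (\<lambda>(d, n). ball d (1 / real (Suc n))) ` (D \<times> UNIV)"
  have "topological_basis B"
  proof (rule topological_basisI)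
    fix U :: "'a set" and x assume "open U" "x \<in> U"
    then obtain e where e: "0 < e" "ball x e \<subseteq> U" using openE by blast
    obtain n where n: "1 / real (Suc n) < e / 2"
      using reals_Archimedean[of "e/2"] e(1) by (auto simp: inverse_eq_divide)
    have "x \<in> closure D" using assms(2) by simp
    then obtain d where d: "d \<in> D" "dist d x < 1 / real (Suc n)"
      using closure_approachable[of x D] by (metis of_nat_0_less_iff zero_less_Suc zero_less_divide_1_iff)
    have "ball d (1 / real (Suc n)) \<subseteq> ball x e"
    proof
      fix y assume "y \<in> ball d (1 / real (Suc n))"
      then show "y \<in> ball x e"
        using d(2) n dist_triangle[of x y d] by (simp add: dist_commute)
    qed
    with d e(2) show "\<exists>B'\<in>B. x \<in> B' \<and> B' \<subseteq> U"
      unfolding B_def by (intro bexI[of _ "ball d (1 / real (Suc n))"]) auto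
  qed (auto simp: B_def)
  moreover have "countable B"
    unfolding B_def using assms(1) by (intro countable_image countable_SIGMA) auto
  ultimately show ?thesis using topological_basis_imp_subbasis by blast
qed

lemma to_L2_dominated_convergence:
  assumes "\<And>n. f n \<in> borel_measurable circle_measure" "F \<in> borel_measurable circle_measure"
    and h: "square_integrable h"
    and bound: "\<And>n z. norm (f n z) \<le> norm (h z)"
    and lim: "\<And>z. (\<lambda>n. f n z) \<longlonglongrightarrow> F z"
  shows "(\<lambda>n. to_L2 (f n)) \<longlonglongrightarrow> to_L2 F"
proof -
  note [measurable] = assms(1,2)
  have Fbound: "norm (F z) \<le> norm (h z)" for z
    using tendsto_norm[OF lim[of z]] by (rule LIMSEQ_le_const2) (use bound in auto)
  have f: "square_integrable (f n)" for n
    by (rule square_integrable_mono[OF h, where c = 1]) (auto simp: bound)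
  have F: "square_integrable F"
    by (rule square_integrable_mono[OF h, where c = 1]) (auto simp: Fbound)
  have int_h: "integrable circle_measure (\<lambda>z. 4 * (norm (h z))\<^sup>2)"
    using h by (simp add: square_integrable_def)
  have "(\<lambda>n. integral\<^sup>L circle_measure (\<lambda>z. (norm (f n z - F z))\<^sup>2)) \<longlonglongrightarrow>
      integral\<^sup>L circle_measure (\<lambda>_. 0)"
  proof (rule integral_dominated_convergence[OF _ _ int_h])
    show "AE z in circle_measure. (\<lambda>n. (norm (f n z - F z))\<^sup>2) \<longlonglongrightarrow> 0"
    proof (rule AE_I2)
      fix z
      have "(\<lambda>n. (norm (f n z - F z))\<^sup>2) \<longlonglongrightarrow> (norm (F z - F z))\<^sup>2"
        by (intro tendsto_intros lim)
      then show "(\<lambda>n. (norm (f n z - F z))\<^sup>2) \<longlonglongrightarrow> 0" by simp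
    qed
    show "AE z in circle_measure. norm ((norm (f n z - F z))\<^sup>2) \<le> 4 * (norm (h z))\<^sup>2" for n
    proof (rule AE_I2)
      fix z
      have "norm (f n z - F z) \<le> 2 * norm (h z)"
        using norm_triangle_ineq4[of "f n z" "F z"] bound[of n z] Fbound[of z] by linarith
      then have "(norm (f n z - F z))\<^sup>2 \<le> (2 * norm (h z))\<^sup>2" by (rule power_mono) simp
      then show "norm ((norm (f n z - F z))\<^sup>2) \<le> 4 * (norm (h z))\<^sup>2" by (simp add: power_mult_distrib)
    qed
  qed auto
  then have "(\<lambda>n. (norm (to_L2 (f n) - to_L2 F))\<^sup>2) \<longlonglongrightarrow> 0"
    by (simp add: to_L2_diff[symmetric] norm_to_L2 square_integrable_diff f F)
  then have "(\<lambda>n. sqrt ((norm (to_L2 (f n) - to_L2 F))\<^sup>2)) \<longlonglongrightarrow> sqrt 0"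
    by (rule tendsto_real_sqrt)
  then have "(\<lambda>n. norm (to_L2 (f n) - to_L2 F)) \<longlonglongrightarrow> 0" by simp
  then show ?thesis by (simp add: LIM_zero_iff tendsto_norm_zero_iff)
qed

lemma ex_countable_Int_stable_generator:
  obtains \<G> :: "'a::second_countable_topology set set"
  where "countable \<G>" "Int_stable \<G>" "UNIV \<in> \<G>" "sets borel = sigma_sets UNIV \<G>"
proof -
  obtain G :: "'a set set" where G: "countable G" "topological_basis G"
    using ex_countable_basis by blast
  define \<G> where "\<G> = Inter ` {K. finite K \<and> K \<subseteq> G}"
  have "countable \<G>"
    unfolding \<G>_def using G(1) by (intro countable_image countable_Collect_finite_subset)
  moreover have "Int_stable \<G>"
  proof (rule Int_stableI)
    fix a b assume "a \<in> \<G>" "b \<in> \<G>"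
    then obtain K L where "finite K" "K \<subseteq> G" "a = \<Inter>K" "finite L" "L \<subseteq> G" "b = \<Inter>L"
      unfolding \<G>_def by blast
    then show "a \<inter> b \<in> \<G>"
      unfolding \<G>_def by (intro image_eqI[of _ _ "K \<union> L"]) auto
  qed
  moreover have "UNIV \<in> \<G>"
    unfolding \<G>_def by (rule image_eqI[of _ _ "{}"]) auto
  moreover have "sets borel = sigma_sets UNIV \<G>"
  proof
    have "G \<subseteq> \<G>"
    proof
      fix x assume "x \<in> G"
      then show "x \<in> \<G>" unfolding \<G>_def by (intro image_eqI[of _ _ "{x}"]) auto
    qed
    then show "sets borel \<subseteq> sigma_sets UNIV \<G>"
      by (simp add: borel_eq_countable_basis[OF G] sigma_sets_mono')
    have "\<G> \<subseteq> sets borel"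
    proof
      fix x assume "x \<in> \<G>"
      then obtain K where "finite K" "K \<subseteq> G" "x = \<Inter>K" unfolding \<G>_def by blast
      then have "open x" using topological_basis_open[OF G(2)] by (auto intro!: open_Inter)
      then show "x \<in> sets borel" by simp
    qed
    then show "sigma_sets UNIV \<G> \<subseteq> sets borel"
      using sets.sigma_sets_subset[of \<G> borel] by simp
  qed
  ultimately show thesis by (rule that)
qed

lemma circle_L2_separable:
  obtains D :: "circle_L2 set" where "countable D" "closure D = UNIV"
proof -
  obtain \<G> :: "complex set set" where \<G>: "countable \<G>" "Int_stable \<G>" "UNIV \<in> \<G>"
    "sets borel = sigma_sets UNIV \<G>"
    by (rule ex_countable_Int_stable_generator)
  define B where "B = (\<lambda>(c, A). to_L2 (\<lambda>z. c * complex_of_real (indicator A z))) ` ({1, \<i>} \<times> \<G>)"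
  have "countable B"
    unfolding B_def using \<G>(1) by (intro countable_image countable_SIGMA) auto
  then obtain D where D: "countable D" "B \<subseteq> closure D" "subspace (closure D)"
    by (rule ex_countable_rational_span)
  have ind: "to_L2 (\<lambda>z. c * complex_of_real (indicator A z)) \<in> closure D"
    if c: "c \<in> {1, \<i>}" and "A \<in> sets borel" for c A
  proof -
    have sqi: "square_integrable (\<lambda>z. c * complex_of_real (indicator A z))" if "A \<in> sets borel" for A
      by (rule square_integrable_mono[OF square_integrable_const[of c], where c = 1])
        (use that in \<open>auto simp: indicator_def norm_mult\<close>)
    have "A \<in> sigma_sets UNIV \<G>" using \<open>A \<in> sets borel\<close> \<G>(4) by simp
    from \<G>(2) subset_Pow_Union[of \<G>, THEN subset_trans, OF Pow_mono[OF subset_UNIV]] this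
    show ?thesis
    proof (induction rule: sigma_sets_induct_disjoint)
      case (basic A)
      with c D(2) show ?case unfolding B_def by blast
    next
      case empty
      then show ?case using D(3) by (simp add: subspace_0)
    next
      case (compl A)
      then have "A \<in> sets borel" using \<G>(4) by simp
      have "(\<lambda>z. c * complex_of_real (indicator (UNIV - A) z))
          = (\<lambda>z. c * complex_of_real (indicator UNIV z) - c * complex_of_real (indicator A z))"
        by (auto simp: indicator_def)
      then have "to_L2 (\<lambda>z. c * complex_of_real (indicator (UNIV - A) z))
          = to_L2 (\<lambda>z. c * complex_of_real (indicator UNIV z)) - to_L2 (\<lambda>z. c * complex_of_real (indicator A z))"
        using sqi[of UNIV] sqi[OF \<open>A \<in> sets borel\<close>] to_L2_diff by simp
      moreover have "to_L2 (\<lambda>z. c * complex_of_real (indicator UNIV z)) \<in> closure D"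
        using c \<G>(3) D(2) unfolding B_def by blast
      ultimately show ?case using compl D(3) by (simp add: subspace_diff)
    next
      case (union A)
      then have A: "A i \<in> sets borel" for i using \<G>(4) by auto
      have part: "to_L2 (\<lambda>z. c * complex_of_real (indicator (\<Union>i<n. A i) z)) \<in> closure D" for n :: nat
      proof (induction n)
        case 0
        then show ?case using D(3) by (simp add: subspace_0)
      next
        case (Suc n)
        have disj: "(\<Union>i<n. A i) \<inter> A n = {}"
        proof -
          have "A i \<inter> A n = {}" if "i < n" for i
            using that by (intro disjoint_family_onD[OF union(1)]) simp_all
          then show ?thesis by blast
        qed
        have "(\<Union>i<Suc n. A i) = (\<Union>i<n. A i) \<union> A n" by (auto simp: less_Suc_eq)
        with disj have "(\<lambda>z. c * complex_of_real (indicator (\<Union>i<Suc n. A i) z))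
            = (\<lambda>z. c * complex_of_real (indicator (\<Union>i<n. A i) z) + c * complex_of_real (indicator (A n) z))"
          by (auto simp: indicator_def fun_eq_iff)
        moreover have "(\<Union>i<n. A i) \<in> sets borel" using A by auto
        ultimately have "to_L2 (\<lambda>z. c * complex_of_real (indicator (\<Union>i<Suc n. A i) z))
            = to_L2 (\<lambda>z. c * complex_of_real (indicator (\<Union>i<n. A i) z))
              + to_L2 (\<lambda>z. c * complex_of_real (indicator (A n) z))"
          by (simp only: to_L2_add sqi A)
        then show ?case using Suc union D(3) by (simp add: subspace_add)
      qed
      have "(\<lambda>n. to_L2 (\<lambda>z. c * complex_of_real (indicator (\<Union>i<n. A i) z)))
          \<longlonglongrightarrow> to_L2 (\<lambda>z. c * complex_of_real (indicator (\<Union>i. A i) z))"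
      proof (rule to_L2_dominated_convergence[OF _ _ square_integrable_const[of c]])
        show "(\<lambda>n. c * complex_of_real (indicator (\<Union>i<n. A i) z))
            \<longlonglongrightarrow> c * complex_of_real (indicator (\<Union>i. A i) z)" for z
          by (intro tendsto_intros LIMSEQ_indicator_UN)
      qed (use A in \<open>auto simp: indicator_def norm_mult\<close>)
      from closed_sequentially[OF closed_closure part this] show ?case .
    qed
  qed
  have nonneg: "square_integrable (\<lambda>z. c * complex_of_real (u z)) \<longrightarrow>
      to_L2 (\<lambda>z. c * complex_of_real (u z)) \<in> closure D"
    if c: "c \<in> {1, \<i>}" and u: "u \<in> borel_measurable circle_measure" "\<And>z. 0 \<le> u z" for c u
  proof -
    have nc: "norm c = 1" using c by auto
    from u show ?thesis
    proof (induction rule: borel_measurable_induct_real)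
      case (set A)
      then show ?case using ind[OF c] by simp
    next
      case (mult u a)
      show ?case
      proof (cases "a = 0")
        case True
        then show ?thesis using D(3) by (simp add: subspace_0)
      next
        case False
        show ?thesis
        proof
          assume sq: "square_integrable (\<lambda>z. c * complex_of_real (a * u z))"
          have [measurable]: "u \<in> borel_measurable circle_measure" by (rule mult)
          have "square_integrable (\<lambda>z. c * complex_of_real (u z))"
            using square_integrable_scaleR[OF sq, of "1 / a"] False by (simp add: scaleR_conv_of_real)
          then have "to_L2 (\<lambda>z. a *\<^sub>R (c * complex_of_real (u z))) \<in> closure D"
            using mult D(3) to_L2_scaleR subspace_scale by metis
          then show "to_L2 (\<lambda>z. c * complex_of_real (a * u z)) \<in> closure D"
            by (simp add: scaleR_conv_of_real mult_ac)
        qed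
      qed
    next
      case (add u v)
      show ?case
      proof
        assume sq: "square_integrable (\<lambda>z. c * complex_of_real (v z + u z))"
        have "square_integrable (\<lambda>z. c * complex_of_real (u z))"
          by (rule square_integrable_mono[OF sq, where c = 1])
            (use add nc in \<open>auto simp: norm_mult simp flip: of_real_add\<close>)
        moreover have "square_integrable (\<lambda>z. c * complex_of_real (v z))"
          by (rule square_integrable_mono[OF sq, where c = 1])
            (use add nc in \<open>auto simp: norm_mult simp flip: of_real_add\<close>)
        ultimately have "to_L2 (\<lambda>z. c * complex_of_real (v z) + c * complex_of_real (u z)) \<in> closure D"
          using add D(3) by (simp only: to_L2_add subspace_add)
        then show "to_L2 (\<lambda>z. c * complex_of_real (v z + u z)) \<in> closure D"
          by (simp add: distrib_left)
      qed
    next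
      case (seq U)
      have le: "U i z \<le> u z" for i z
        using incseq_le[of "\<lambda>i. U i z" "u z"] seq by (auto simp: incseq_def le_fun_def)
      have [measurable]: "U i \<in> borel_measurable circle_measure" for i by (rule seq)
      have [measurable]: "u \<in> borel_measurable circle_measure" by (rule u(1))
      show ?case
      proof
        assume sq: "square_integrable (\<lambda>z. c * complex_of_real (u z))"
        have bound: "norm (c * complex_of_real (U i z)) \<le> norm (c * complex_of_real (u z))" for i z
          using le[of i z] seq(2)[of i z] nc by (simp add: norm_mult)
        have "square_integrable (\<lambda>z. c * complex_of_real (U i z))" for i
          by (rule square_integrable_mono[OF sq, where c = 1]) (use bound in auto)
        then have mem: "to_L2 (\<lambda>z. c * complex_of_real (U i z)) \<in> closure D" for i
          using seq by blast
        have "(\<lambda>i. to_L2 (\<lambda>z. c * complex_of_real (U i z))) \<longlonglongrightarrow> to_L2 (\<lambda>z. c * complex_of_real (u z))"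
          by (rule to_L2_dominated_convergence[OF _ _ sq bound])
            (use seq in \<open>auto intro!: tendsto_intros\<close>)
        from closed_sequentially[OF closed_closure mem this]
        show "to_L2 (\<lambda>z. c * complex_of_real (u z)) \<in> closure D" .
      qed
    qed
  qed
  have part: "square_integrable (\<lambda>z. c * complex_of_real (g (f z)))"
      "to_L2 (\<lambda>z. c * complex_of_real (g (f z))) \<in> closure D"
    if f: "square_integrable f" and g: "g \<in> borel_measurable borel" "\<And>w. 0 \<le> g w" "\<And>w. g w \<le> norm w"
      and c: "c \<in> {1, \<i>}" for f g c
  proof -
    have [measurable]: "f \<in> borel_measurable circle_measure" "g \<in> borel_measurable borel"
      using f g by (auto simp: square_integrable_def)
    show sq: "square_integrable (\<lambda>z. c * complex_of_real (g (f z)))"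
      by (rule square_integrable_mono[OF f, where c = 1]) (use c g in \<open>auto simp: norm_mult\<close>)
    show "to_L2 (\<lambda>z. c * complex_of_real (g (f z))) \<in> closure D"
      using nonneg[OF c, of "\<lambda>z. g (f z)"] sq g(2) by simp
  qed
  have "x \<in> closure D" for x
  proof -
    define f where "f = rep_circle_L2 x"
    have f: "square_integrable f" and x: "x = to_L2 f"
      by (simp_all add: f_def square_integrable_rep)
    define g1 g2 g3 g4 :: "complex \<Rightarrow> real" where "g1 w = max 0 (Re w)" and "g2 w = max 0 (- Re w)"
      and "g3 w = max 0 (Im w)" and "g4 w = max 0 (- Im w)" for w
    note gdefs = g1_def[abs_def] g2_def[abs_def] g3_def[abs_def] g4_def[abs_def]
    have Re: "\<bar>Re w\<bar> \<le> norm w" and Im: "\<bar>Im w\<bar> \<le> norm w" for w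
      by (rule abs_Re_le_cmod, rule abs_Im_le_cmod)
    have g: "g \<in> borel_measurable borel \<and> (\<forall>w. 0 \<le> g w) \<and> (\<forall>w. g w \<le> norm w)"
      if "g \<in> {g1, g2, g3, g4}" for g
    proof -
      have "g1 \<in> borel_measurable borel" "g2 \<in> borel_measurable borel"
        "g3 \<in> borel_measurable borel" "g4 \<in> borel_measurable borel"
        unfolding gdefs by measurable
      moreover have "0 \<le> g w" for w
        using that by (auto simp: gdefs)
      moreover have "g w \<le> norm w" for w
        using that abs_le_D1[OF Re[of w]] abs_le_D2[OF Re[of w]] abs_le_D1[OF Im[of w]] abs_le_D2[OF Im[of w]]
        by (auto simp: gdefs)
      ultimately show ?thesis using that by auto
    qed
    have p: "square_integrable (\<lambda>z. c * complex_of_real (g (f z))) \<and>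
        to_L2 (\<lambda>z. c * complex_of_real (g (f z))) \<in> closure D"
      if "g \<in> {g1, g2, g3, g4}" "c \<in> {1, \<i>}" for g c
      using part[OF f, of g c] g[OF that(1)] that(2) by blast
    define a1 a2 a3 a4 where "a1 z = 1 * complex_of_real (g1 (f z))" and "a2 z = 1 * complex_of_real (g2 (f z))"
      and "a3 z = \<i> * complex_of_real (g3 (f z))" and "a4 z = \<i> * complex_of_real (g4 (f z))" for z
    note adefs = a1_def[abs_def] a2_def[abs_def] a3_def[abs_def] a4_def[abs_def]
    have sq: "square_integrable a1" "square_integrable a2" "square_integrable a3" "square_integrable a4"
      and mem: "to_L2 a1 \<in> closure D" "to_L2 a2 \<in> closure D" "to_L2 a3 \<in> closure D" "to_L2 a4 \<in> closure D"
      unfolding adefs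
      using p[of g1 1] p[of g2 1] p[of g3 \<i>] p[of g4 \<i>] by blast+
    have "f = (\<lambda>z. (a1 z - a2 z) + (a3 z - a4 z))"
      by (auto simp: adefs gdefs complex_eq_iff max_def)
    then have "to_L2 f = to_L2 (\<lambda>z. (a1 z - a2 z) + (a3 z - a4 z))" by (rule arg_cong)
    also have "\<dots> = (to_L2 a1 - to_L2 a2) + (to_L2 a3 - to_L2 a4)"
      by (simp only: to_L2_add[OF square_integrable_diff square_integrable_diff] to_L2_diff sq)
    also have "\<dots> \<in> closure D"
      using D(3) mem by (simp only: subspace_add subspace_diff)
    finally show ?thesis using x by simp
  qed
  then show thesis using D(1) that by blast
qed

instance circle_L2 :: second_countable_topology
proof
  obtain D :: "circle_L2 set" where "countable D" "closure D = UNIV" by (rule circle_L2_separable)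
  then show "\<exists>B::circle_L2 set set. countable B \<and> open = generate_topology B"
    by (rule second_countable_if_separable)
qed

section \<open>Fourier series, the Riesz projector and the Hardy space\<close>

lemma borel_measurable_power_int [measurable]:
  "(\<lambda>z::complex. z powi n) \<in> borel_measurable circle_measure"
  by (cases "0 \<le> n") (simp_all add: power_int_def)

lift_definition fourier_coeff :: "circle_L2 \<Rightarrow> int \<Rightarrow> complex" is
  "\<lambda>f n. 1 / (2 * pi) * (LINT z|circle_measure. f z * z powi (- n))"
proof (intro ext)
  fix f g :: "complex \<Rightarrow> complex" and n
  assume *: "square_integrable f \<and> square_integrable g \<and> (AE z in circle_measure. f z = g z)"
  then have [measurable]: "f \<in> borel_measurable circle_measure" "g \<in> borel_measurable circle_measure"
    by (auto simp: square_integrable_def)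
  have "(LINT z|circle_measure. f z * z powi (- n)) = (LINT z|circle_measure. g z * z powi (- n))"
    using * by (intro integral_cong_AE) (auto elim: AE_mp)
  then show "1 / (2 * pi) * (LINT z|circle_measure. f z * z powi (- n))
      = 1 / (2 * pi) * (LINT z|circle_measure. g z * z powi (- n))"
    by simp
qed

text \<open>
  The sums are unconditional sums in the Hilbert space \<^typ>\<open>circle_L2\<close>; they always exist, since
  the monomials are orthogonal and Fourier coefficients are square-summable.
\<close>

definition riesz_projector :: "circle_L2 \<Rightarrow> circle_L2" where
  "riesz_projector f = (\<Sum>\<^sub>\<infinity>n\<in>{0..}. to_L2 (\<lambda>z. fourier_coeff f n * z powi n))"

definition half_heat_semigroup :: "real \<Rightarrow> circle_L2 \<Rightarrow> circle_L2" where
  "half_heat_semigroup t f =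
     (\<Sum>\<^sub>\<infinity>n::int. to_L2 (\<lambda>z. fourier_coeff f n * of_real (exp (- real_of_int \<bar>n\<bar> * t)) * z powi n))"

definition hardy_space :: "circle_L2 set" where
  "hardy_space = range riesz_projector"

definition hardy_function :: "circle_L2 \<Rightarrow> complex \<Rightarrow> complex" where
  "hardy_function f z = (\<Sum>n::nat. fourier_coeff f (int n) * z ^ n)"


section \<open>The control system on the Hardy space\<close>

definition open_strict_interval :: "complex set \<Rightarrow> bool" where
  "open_strict_interval \<omega> \<longleftrightarrow> (\<exists>a b. 0 < b - a \<and> b - a < 2 * pi \<and> \<omega> = cis ` {a<..<b})"

definition control_L2 :: "complex set \<Rightarrow> real \<Rightarrow> (real \<times> complex \<Rightarrow> complex) set" where
  "control_L2 \<omega> T = {u.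
     set_borel_measurable (lborel \<Otimes>\<^sub>M circle_measure) ({0..T} \<times> \<omega>) u \<and>
     set_integrable (lborel \<Otimes>\<^sub>M circle_measure) ({0..T} \<times> \<omega>) (\<lambda>p. (norm (u p))\<^sup>2)}"

text \<open>
  The Duhamel formula, with a Bochner integral in \<^typ>\<open>circle_L2\<close>.  By Fubini, the slices
  of \<open>u\<close> are square-integrable for almost every \<open>s\<close>; the integrand is \<open>0\<close> for the other \<open>s\<close>.
\<close>

definition final_state ::
    "complex set \<Rightarrow> real \<Rightarrow> circle_L2 \<Rightarrow> (real \<times> complex \<Rightarrow> complex) \<Rightarrow> circle_L2" where
  "final_state \<omega> T f\<^sub>0 u =
     half_heat_semigroup T f\<^sub>0 +
     (LINT s:{0..T}|lborel.
        half_heat_semigroup (T - s) (riesz_projector (to_L2 (\<lambda>z. indicator \<omega> z * u (s, z)))))"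

definition null_controllable_H2 :: "complex set \<Rightarrow> real \<Rightarrow> circle_L2 set" where
  "null_controllable_H2 \<omega> T = {f\<^sub>0 \<in> hardy_space. \<exists>u \<in> control_L2 \<omega> T. final_state \<omega> T f\<^sub>0 u = 0}"


section \<open>The Riemann sphere\<close>

datatype riemann_sphere = Point complex | Infinity

definition chart_at_infinity :: "complex \<Rightarrow> riemann_sphere" where
  "chart_at_infinity w = (if w = 0 then Infinity else Point (1 / w))"

text \<open>Holomorphy of \<open>F\<close> on an open subset \<open>U\<close> of the sphere, in the two standard charts.\<close>

definition sphere_holomorphic_on :: "(riemann_sphere \<Rightarrow> complex) \<Rightarrow> riemann_sphere set \<Rightarrow> bool" where
  "sphere_holomorphic_on F U \<longleftrightarrow>
     (\<lambda>z. F (Point z)) holomorphic_on (Point -` U) \<and>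
     (\<lambda>w. F (chart_at_infinity w)) holomorphic_on (chart_at_infinity -` U)"

end

theory Submission
  imports Defs
begin

text \<open>
  Reading the equation \<open>f(T) = 0\<close> on the Fourier coefficients of nonnegative index and inserting it in
  the power series of \<open>f\<^sub>0\<close> shows that, near \<open>0\<close>, \<open>f\<^sub>0\<close> is the Cauchy transform
  \<open>z \<mapsto> \<integral>\<integral> g(s, \<zeta>) / (\<zeta> e\<^sup>-\<^sup>s - z) ds |d\<zeta>|\<close> of \<open>g = - u \<zeta> e\<^sup>-\<^sup>s / 2\<pi>\<close>.  It is holomorphic off the
  closed sector of the points \<open>\<zeta> e\<^sup>-\<^sup>s\<close> with \<open>\<zeta>\<close> in the closure of \<open>\<omega>\<close>, and vanishes at infinity.  The disk minus
  the sector is starlike about \<open>0\<close>, so the transform continues \<open>f\<^sub>0\<close> outside the disk.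

  At infinity the transform is the Laurent series with coefficients \<open>- d\<^sub>n\<close> of \<open>z\<^sup>-\<^sup>n\<^sup>-\<^sup>1\<close>, where \<open>d\<^sub>n\<close> is the
  integral of \<open>g (\<zeta> e\<^sup>-\<^sup>s)\<^sup>n\<close>, and the Dirichlet integral is \<open>\<pi> \<Sum> (n + 1) |d\<^sub>n|\<^sup>2\<close>.  Since
  \<open>(\<zeta> e\<^sup>-\<^sup>s)\<^sup>n\<^sup>+\<^sup>1\<close> has squared norm at most \<open>\<pi> / (n + 1)\<close> and these functions are orthogonal, duality bounds the
  sum by the squared norm of \<open>u\<close>.
\<close>

section \<open>Fourier coefficients\<close>

lemma LINT_circle:
  fixes f :: "complex \<Rightarrow> complex"
  assumes "f \<in> borel_measurable borel"
  shows "(LINT z|circle_measure. f z) = (LINT x:{0..<2*pi}|lborel. f (cis x))"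
  unfolding circle_measure_def set_lebesgue_integral_def
  by (subst integral_distr) (use assms in \<open>auto simp: integral_restrict_space\<close>)

text \<open>Kept general in the Euclidean space because Fubini is applied in two settings: on the
  line for the time variable, and on the plane for averages over rotations.\<close>

interpretation lborel_circle: pair_sigma_finite "lborel :: 'a::euclidean_space measure" circle_measure
  by (intro pair_sigma_finite.intro lborel.sigma_finite_measure_axioms circle.sigma_finite_measure_axioms)

lemma emeasure_circle_measure: "emeasure circle_measure UNIV = ennreal (2 * pi)"
  unfolding circle_measure_def
  by (subst emeasure_distr) (auto simp: space_restrict_space emeasure_restrict_space)

text \<open>\<open>circle_measure\<close> lives on the whole plane and is merely concentrated on the
  circle, so identities that use \<open>norm z = 1\<close>, such as
  \<open>cnj z = inverse z\<close>, are available almost everywhere only.\<close>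

lemma AE_circle_norm: "AE z in circle_measure. norm z = 1"
  unfolding circle_measure_def
  by (subst AE_distr_iff) auto

section \<open>Orthogonality of the monomials and Bessel's inequality\<close>

lemma integral_power_int_circle:
  "(LINT z|circle_measure. z powi k) = (if k = 0 then 2 * pi else 0)"
proof (cases "k = 0")
  case True
  have "measure circle_measure UNIV = 2 * pi"
    by (simp add: measure_def emeasure_circle_measure)
  with True show ?thesis by (simp add: scaleR_conv_of_real)
next
  case False
  have [measurable]: "(\<lambda>z::complex. z powi k) \<in> borel_measurable borel"
    using borel_measurable_power_int[of k] by simp
  define F where "F x = cis (of_int k * x) / (\<i> * of_int k)" for x
  have deriv: "(F has_vector_derivative cis (of_int k * x)) (at x within {0..2*pi})" for x
    unfolding F_def cis_conv_exp
    by (rule derivative_eq_intros has_vector_derivative_real_field | use False in \<open>auto simp: field_simps\<close>)+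
  have "((\<lambda>x. cis (of_int k * x)) has_integral (F (2*pi) - F 0)) {0..2*pi}"
    using deriv by (intro fundamental_theorem_of_calculus) auto
  moreover have "F (2*pi) = F 0"
    using cis_multiple_2pi[of "of_int k"] by (simp add: F_def mult_ac)
  ultimately have hi: "((\<lambda>x. cis (of_int k * x)) has_integral 0) {0..2*pi}" by simp
  have "continuous_on UNIV (\<lambda>x. cis (of_int k * x))" by (intro continuous_intros)
  then have measurable [measurable]: "(\<lambda>x. cis (of_int k * x)) \<in> borel_measurable borel"
    by (rule borel_measurable_continuous_onI)
  have si: "set_integrable lborel {0..2*pi} (\<lambda>x. cis (of_int k * x))"
    by (intro borel_integrable_atLeastAtMost') (intro continuous_intros)
  have "(LINT z|circle_measure. z powi k) = (LINT x:{0..<2*pi}|lborel. cis (of_int k * x))"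
    by (subst LINT_circle) (auto simp: cis_power_int)
  also have "\<dots> = (LINT x:{0..2*pi}|lborel. cis (of_int k * x))"
    unfolding set_lebesgue_integral_def
  proof (rule integral_cong_AE)
    show "AE x in lborel. indicat_real {0..<2 * pi} x *\<^sub>R cis (real_of_int k * x) =
             indicat_real {0..2 * pi} x *\<^sub>R cis (real_of_int k * x)"
      using AE_lborel_singleton[of "2*pi"] by eventually_elim (auto simp: indicator_def)
  qed (use measurable in auto)
  also have "\<dots> = integral {0..2*pi} (\<lambda>x. cis (of_int k * x))"
    by (rule set_borel_integral_eq_integral(2)[OF si])
  also have "\<dots> = 0" using hi by (rule integral_unique)
  finally show ?thesis using False by simp
qed

lemma square_integrable_monomial: "square_integrable (\<lambda>z. c * z powi n)"
proof (rule square_integrable_cmult)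
  have "integrable circle_measure (\<lambda>z. (norm (z powi n))\<^sup>2)"
  proof (rule circle.integrable_const_bound[where B = 1])
    show "AE z in circle_measure. norm ((norm (z powi n))\<^sup>2) \<le> 1"
      using AE_circle_norm by eventually_elim (simp add: norm_power_int)
  qed simp
  then show "square_integrable (\<lambda>z. z powi n)" by (simp add: square_integrable_def)
qed

lemma inner_eq_Re_mult_cnj: "inner a b = Re (a * cnj b)"
  by (simp add: inner_complex_def)

lemma integrable_square_integrable_mult:
  assumes "square_integrable f" "square_integrable g"
  shows "integrable circle_measure (\<lambda>z. f z * g z)"
proof -
  have [measurable]: "f \<in> borel_measurable circle_measure" "g \<in> borel_measurable circle_measure"
    using assms by (auto simp: square_integrable_def)
  have "integrable circle_measure (\<lambda>z. (norm (f z))\<^sup>2 + (norm (g z))\<^sup>2)"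
    using assms by (simp add: square_integrable_def)
  then show ?thesis
  proof (rule Bochner_Integration.integrable_bound)
    have "norm (a * b) \<le> (norm a)\<^sup>2 + (norm b)\<^sup>2" for a b :: complex
      using sum_squares_bound[of "norm a" "norm b"] mult_nonneg_nonneg[OF norm_ge_zero[of a] norm_ge_zero[of b]]
      unfolding norm_mult by linarith
    then show "AE z in circle_measure. norm (f z * g z) \<le> norm ((norm (f z))\<^sup>2 + (norm (g z))\<^sup>2)"
      by simp
  qed auto
qed

lemma integrable_mult_power_int:
  "square_integrable f \<Longrightarrow> integrable circle_measure (\<lambda>z. f z * z powi n)"
  using integrable_square_integrable_mult[OF _ square_integrable_monomial[of 1 n]] by simp

lemma fourier_coeff_to_L2:
  "square_integrable f \<Longrightarrow>
     fourier_coeff (to_L2 f) n = 1 / (2 * pi) * (LINT z|circle_measure. f z * z powi (- n))"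
  by (simp add: to_L2_def fourier_coeff.abs_eq)

text \<open>On the circle \<open>cnj z\<close> is \<open>inverse z\<close>, so pairing with a
  monomial produces a Fourier coefficient. The inner product is only the real part of the Hermitian
  one; the free scalar \<open>c\<close> makes up for the lost imaginary part.\<close>

lemma inner_to_L2_monomial:
  assumes "square_integrable f"
  shows "inner (to_L2 f) (to_L2 (\<lambda>z. c * z powi n)) = 2 * pi * Re (fourier_coeff (to_L2 f) n * cnj c)"
proof -
  have [measurable]: "f \<in> borel_measurable circle_measure"
    using assms by (auto simp: square_integrable_def)
  have "inner (to_L2 f) (to_L2 (\<lambda>z. c * z powi n)) =
      (LINT z|circle_measure. inner (f z) (c * z powi n))"
    by (rule inner_to_L2[OF assms square_integrable_monomial])
  also have "\<dots> = (LINT z|circle_measure. Re (cnj c * (f z * z powi (- n))))"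
  proof (intro integral_cong_AE)
    show "AE z in circle_measure. inner (f z) (c * z powi n) = Re (cnj c * (f z * z powi (- n)))"
      using AE_circle_norm
    proof eventually_elim
      fix z :: complex assume "norm z = 1"
      then have "cnj z = inverse z"
        using divide_conv_cnj[of z 1] by (simp add: inverse_eq_divide)
      then have "cnj (z powi n) = z powi (- n)"
        by (simp add: power_int_def power_inverse)
      then show "inner (f z) (c * z powi n) = Re (cnj c * (f z * z powi (- n)))"
        unfolding inner_eq_Re_mult_cnj complex_cnj_mult by (simp only: mult_ac)
    qed
  qed auto
  also have "\<dots> = Re (LINT z|circle_measure. cnj c * (f z * z powi (- n)))"
    by (intro integral_Re integrable_mult_right integrable_mult_power_int assms)
  also have "\<dots> = 2 * pi * Re (fourier_coeff (to_L2 f) n * cnj c)"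
    by (simp add: fourier_coeff_to_L2[OF assms] integral_mult_right_zero mult_ac)
  finally show ?thesis .
qed

lemma inner_monomial:
  "inner f (to_L2 (\<lambda>z. c * z powi n)) = 2 * pi * Re (fourier_coeff f n * cnj c)"
  using inner_to_L2_monomial[OF square_integrable_rep, of f] by simp

lemma fourier_coeff_monomial:
  "fourier_coeff (to_L2 (\<lambda>z. c * z powi m)) n = (if m = n then c else 0)"
proof -
  have "fourier_coeff (to_L2 (\<lambda>z. c * z powi m)) n
      = 1 / (2 * pi) * (LINT z|circle_measure. c * z powi m * z powi (- n))"
    by (rule fourier_coeff_to_L2[OF square_integrable_monomial])
  also have "(LINT z|circle_measure. c * z powi m * z powi (- n)) = (LINT z|circle_measure. c * z powi (m - n))"
  proof (intro integral_cong_AE)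
    show "AE z in circle_measure. c * z powi m * z powi (- n) = c * z powi (m - n)"
      using AE_circle_norm 
    proof eventually_elim
      fix z :: complex assume "norm z = 1"
      then have "z \<noteq> 0" by auto
      then show "c * z powi m * z powi (- n) = c * z powi (m - n)"
        by (simp add: power_int_diff power_int_minus field_simps)
    qed
  qed auto
  also have "\<dots> = c * (if m = n then 2 * pi else 0)"
    by (simp add: integral_power_int_circle)
  finally show ?thesis by simp
qed

lemma norm_monomial: "(norm (to_L2 (\<lambda>z. c * z powi n)))\<^sup>2 = 2 * pi * (norm c)\<^sup>2"
  by (simp add: power2_norm_eq_inner inner_monomial fourier_coeff_monomial inner_eq_Re_mult_cnj)

text \<open>Pythagoras. The injective index map \<open>k\<close> serves the later sums over natural
  numbers, whose exponents are \<open>n + 1\<close> and \<open>- (n + 2)\<close>.\<close>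

lemma norm_sum_monomials:
  assumes "finite I" "inj_on k I"
  shows "(norm (\<Sum>n\<in>I. to_L2 (\<lambda>z. c n * z powi (k n))))\<^sup>2 = 2 * pi * (\<Sum>n\<in>I. (norm (c n))\<^sup>2)"
  using norm_sum_Pythagorean[OF assms(1), of "\<lambda>n. to_L2 (\<lambda>z. c n * z powi (k n))"] assms(2)
  by (simp add: pairwise_def orthogonal_def inner_monomial fourier_coeff_monomial norm_monomial
      sum_distrib_left inj_on_eq_iff)

lemma to_L2_sum:
  assumes "finite I" "\<And>i. i \<in> I \<Longrightarrow> square_integrable (f i)"
  shows "square_integrable (\<lambda>z. \<Sum>i\<in>I. f i z)" "to_L2 (\<lambda>z. \<Sum>i\<in>I. f i z) = (\<Sum>i\<in>I. to_L2 (f i))"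
  using assms
  by (induction I rule: finite_induct) (auto simp: square_integrable_zero square_integrable_add to_L2_add)

lemma nn_integral_circle_trigonometric_sum:
  assumes "finite I" "inj_on k I"
  shows "(\<integral>\<^sup>+z. ennreal ((norm (\<Sum>n\<in>I. c n * z powi (k n)))\<^sup>2) \<partial>circle_measure)
    = ennreal (2 * pi * (\<Sum>n\<in>I. (norm (c n))\<^sup>2))"
  using assms
  by (simp add: nn_integral_square_integrable to_L2_sum square_integrable_monomial norm_sum_monomials)

text \<open>Expand \<open>0 \<le> (norm (f - S))\<^sup>2\<close> for the partial sum
  \<open>S\<close>: both \<open>inner f S\<close> and \<open>(norm S)\<^sup>2\<close> equal the
  left-hand side. The factor \<open>2 * pi\<close> is there because arc length is not
  normalised.\<close>

lemma fourier_coeff_bessel: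
  assumes "finite I"
  shows "2 * pi * (\<Sum>n\<in>I. (norm (fourier_coeff f n))\<^sup>2) \<le> (norm f)\<^sup>2"
proof -
  define S where "S = (\<Sum>n\<in>I. to_L2 (\<lambda>z. fourier_coeff f n * z powi n))"
  have "inner f S = 2 * pi * (\<Sum>n\<in>I. (norm (fourier_coeff f n))\<^sup>2)"
    by (simp add: S_def inner_sum_right inner_monomial complex_norm_square[symmetric] sum_distrib_left del: of_real_power)
  moreover have "(norm S)\<^sup>2 = 2 * pi * (\<Sum>n\<in>I. (norm (fourier_coeff f n))\<^sup>2)"
    unfolding S_def by (rule norm_sum_monomials[OF assms inj_on_id2])
  moreover have "(norm (f - S))\<^sup>2 = (norm f)\<^sup>2 - 2 * inner f S + (norm S)\<^sup>2"
    by (simp add: power2_norm_eq_inner inner_diff_left inner_diff_right inner_commute)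
  ultimately show ?thesis
    using zero_le_power2[of "norm (f - S)"] by linarith
qed

lemma norm_fourier_coeff_le: "norm (fourier_coeff f n) \<le> norm f"
proof -
  have "(norm (fourier_coeff f n))\<^sup>2 \<le> 2 * pi * (norm (fourier_coeff f n))\<^sup>2"
    using mult_right_mono[of 1 "2 * pi" "(norm (fourier_coeff f n))\<^sup>2"] pi_gt3 by simp
  also have "\<dots> \<le> (norm f)\<^sup>2" using fourier_coeff_bessel[of "{n}" f] by simp
  finally show ?thesis by (simp add: power2_le_iff_abs_le)
qed

section \<open>Continuity of Fourier coefficients and convergence of orthogonal series\<close>

lemma bounded_linear_fourier_coeff: "bounded_linear (\<lambda>f. fourier_coeff f n)"
proof (rule bounded_linear_intro[where K = 1])
  fix f g :: circle_L2 and r :: real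
  show "fourier_coeff (f + g) n = fourier_coeff f n + fourier_coeff g n"
    by transfer (simp add: distrib_right integrable_mult_power_int distrib_left)
  show "fourier_coeff (r *\<^sub>R f) n = r *\<^sub>R fourier_coeff f n"
  proof transfer
    fix n r and f :: "complex \<Rightarrow> complex"
    have "(LINT z|circle_measure. r *\<^sub>R f z * z powi - n) = r *\<^sub>R (LINT z|circle_measure. f z * z powi - n)"
      using integral_scaleR_right[of circle_measure r "\<lambda>z. f z * z powi - n"] by simp
    then show "1 / (2 * pi) * (LINT z|circle_measure. r *\<^sub>R f z * z powi - n)
      = r *\<^sub>R (1 / (2 * pi) * (LINT z|circle_measure. f z * z powi - n))"
      by simp
  qed
  show "norm (fourier_coeff f n) \<le> norm f * 1" using norm_fourier_coeff_le by simp
qed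

text \<open>By Pythagoras, the squared norm of a finite block is the corresponding block of the
  series of squared norms. Hence the net of finite partial sums is Cauchy, and completeness yields a
  limit.\<close>

lemma orthogonal_family_summable_on:
  fixes f :: "'i \<Rightarrow> 'a::{real_inner, banach}"
  assumes orth: "pairwise (\<lambda>i j. orthogonal (f i) (f j)) A"
    and sq: "(\<lambda>i. (norm (f i))\<^sup>2) summable_on A"
  shows "f summable_on A"
proof -
  let ?G = "finite_subsets_at_top A"
  have "cauchy_filter (filtermap (sum f) ?G)"
    unfolding cauchy_filter_metric_filtermap
  proof (intro allI impI)
    fix e :: real assume e: "e > 0"
    have "cauchy_filter (filtermap (sum (\<lambda>i. (norm (f i))\<^sup>2)) ?G)"
      using sq unfolding summable_on_def has_sum_def filterlim_def
      by (auto simp: convergent_filter_iff intro!: convergent_filter_cauchy)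
    moreover have "0 < (e/2)\<^sup>2" using e by simp
    ultimately have "\<exists>P. eventually P ?G \<and> (\<forall>x y. P x \<and> P y \<longrightarrow>
        dist (\<Sum>i\<in>x. (norm (f i))\<^sup>2) (\<Sum>i\<in>y. (norm (f i))\<^sup>2) < (e/2)\<^sup>2)"
      unfolding cauchy_filter_metric_filtermap by (elim allE impE)
    then obtain P where P: "eventually P ?G"
      "\<And>x y. P x \<Longrightarrow> P y \<Longrightarrow> dist (\<Sum>i\<in>x. (norm (f i))\<^sup>2) (\<Sum>i\<in>y. (norm (f i))\<^sup>2) < (e/2)\<^sup>2"
      by metis
    from P(1) obtain X where X: "finite X" "X \<subseteq> A" "\<And>Y. finite Y \<Longrightarrow> X \<subseteq> Y \<Longrightarrow> Y \<subseteq> A \<Longrightarrow> P Y"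
      unfolding eventually_finite_subsets_at_top by metis
    \<comment> \<open>Every later partial sum is compared with the one over the common set
      \<open>X\<close>, which is why the tolerance for the squared norms is
      \<open>(e/2)\<^sup>2\<close>.\<close>
    have close: "norm (sum f Y - sum f X) < e / 2" if Y: "finite Y" "X \<subseteq> Y" "Y \<subseteq> A" for Y
    proof -
      have "sum f Y - sum f X = sum f (Y - X)" using Y X(1) by (simp add: sum_diff)
      moreover have "(norm (sum f (Y - X)))\<^sup>2 = (\<Sum>i\<in>Y - X. (norm (f i))\<^sup>2)"
        using orth Y by (intro norm_sum_Pythagorean) (auto elim: pairwise_subset)
      moreover have "(\<Sum>i\<in>Y - X. (norm (f i))\<^sup>2) = (\<Sum>i\<in>Y. (norm (f i))\<^sup>2) - (\<Sum>i\<in>X. (norm (f i))\<^sup>2)"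
        using Y X(1) by (simp add: sum_diff)
      moreover have "\<dots> < (e/2)\<^sup>2"
        using P(2)[OF X(3)[of Y] X(3)[of X]] Y X by (auto simp: dist_real_def)
      ultimately have "(norm (sum f Y - sum f X))\<^sup>2 < (e/2)\<^sup>2" by simp
      then show ?thesis by (rule power2_less_imp_less) (use e in simp)
    qed
    show "\<exists>P. eventually P ?G \<and> (\<forall>x y. P x \<and> P y \<longrightarrow> dist (sum f x) (sum f y) < e)"
    proof (intro exI conjI allI impI)
      show "eventually (\<lambda>Y. finite Y \<and> X \<subseteq> Y \<and> Y \<subseteq> A) ?G"
        unfolding eventually_finite_subsets_at_top using X by blast
      fix Y Z assume "(finite Y \<and> X \<subseteq> Y \<and> Y \<subseteq> A) \<and> (finite Z \<and> X \<subseteq> Z \<and> Z \<subseteq> A)"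
      then have "norm (sum f Y - sum f X) < e / 2" "norm (sum f Z - sum f X) < e / 2"
        using close by auto
      then show "dist (sum f Y) (sum f Z) < e"
        unfolding dist_norm using norm_triangle_ineq4[of "sum f Y - sum f X" "sum f Z - sum f X"] by simp
    qed
  qed
  then have "convergent_filter (filtermap (sum f) ?G)" by (rule cauchy_filter_convergent)
  then show ?thesis
    unfolding convergent_filter_iff summable_on_def has_sum_def filterlim_def by simp
qed

text \<open>Domination by the coefficients of some \<open>f\<close> covers both operators: the
  projector keeps these coefficients and the semigroup damps them. Square summability is then
  Bessel's inequality.\<close>

lemma monomial_series_summable_on:
  assumes "\<And>n. norm (c n) \<le> norm (fourier_coeff f n)"
  shows "(\<lambda>n. to_L2 (\<lambda>z. c n * z powi n)) summable_on A"
proof (rule orthogonal_family_summable_on)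
  show "pairwise (\<lambda>i j. orthogonal (to_L2 (\<lambda>z. c i * z powi i)) (to_L2 (\<lambda>z. c j * z powi j))) A"
    by (simp add: pairwise_def orthogonal_def inner_monomial fourier_coeff_monomial)
  show "(\<lambda>n. (norm (to_L2 (\<lambda>z. c n * z powi n)))\<^sup>2) summable_on A"
    unfolding norm_monomial
  proof (rule nonneg_bdd_above_summable_on)
    have "(\<Sum>n\<in>F. 2 * pi * (norm (c n))\<^sup>2) \<le> (norm f)\<^sup>2" if "finite F" for F
    proof -
      have "(\<Sum>n\<in>F. 2 * pi * (norm (c n))\<^sup>2) \<le> (\<Sum>n\<in>F. 2 * pi * (norm (fourier_coeff f n))\<^sup>2)"
        using assms by (intro sum_mono mult_left_mono power_mono) auto
      also have "\<dots> \<le> (norm f)\<^sup>2"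
        using fourier_coeff_bessel[OF that, of f] by (simp add: sum_distrib_left)
      finally show ?thesis .
    qed
    then show "bdd_above (sum (\<lambda>n. 2 * pi * (norm (c n))\<^sup>2) ` {F. F \<subseteq> A \<and> finite F})"
      by (auto intro!: bdd_aboveI[where M = "(norm f)\<^sup>2"])
  qed simp
qed

text \<open>A Fourier coefficient is a continuous linear functional, so it can be taken term by
  term, and orthogonality leaves at most one term.\<close>

lemma fourier_coeff_infsum_monomials:
  assumes "\<And>n. norm (c n) \<le> norm (fourier_coeff f n)"
  shows "fourier_coeff (\<Sum>\<^sub>\<infinity>m\<in>A. to_L2 (\<lambda>z. c m * z powi m)) n = (if n \<in> A then c n else 0)"
proof -
  have "((\<lambda>m. fourier_coeff (to_L2 (\<lambda>z. c m * z powi m)) n) has_sum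
      fourier_coeff (\<Sum>\<^sub>\<infinity>m\<in>A. to_L2 (\<lambda>z. c m * z powi m)) n) A"
    by (intro has_sum_bounded_linear[OF bounded_linear_fourier_coeff] has_sum_infsum
        monomial_series_summable_on[OF assms])
  moreover have "((\<lambda>m. fourier_coeff (to_L2 (\<lambda>z. c m * z powi m)) n) has_sum
      (if n \<in> A then c n else 0)) A"
    by (rule has_sum_finite_neutralI[where B = "A \<inter> {n}"]) (auto simp: fourier_coeff_monomial)
  ultimately show ?thesis by (rule has_sum_unique)
qed

lemma fourier_coeff_riesz_projector:
  "fourier_coeff (riesz_projector f) n = (if 0 \<le> n then fourier_coeff f n else 0)"
  unfolding riesz_projector_def by (subst fourier_coeff_infsum_monomials[where f = f]) auto

text \<open>For \<open>0 \<le> t\<close> the exponential factors are at most \<open>1\<close>, which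
  supplies the domination above.\<close>

lemma fourier_coeff_half_heat_semigroup:
  assumes "0 \<le> t"
  shows "fourier_coeff (half_heat_semigroup t f) n
    = fourier_coeff f n * of_real (exp (- real_of_int \<bar>n\<bar> * t))"
  unfolding half_heat_semigroup_def
  using assms
  by (subst fourier_coeff_infsum_monomials[where f = f])
    (auto simp: norm_mult intro!: mult_left_le)

section \<open>Controls on the product of time and circle, and the terminal condition\<close>

abbreviation time_circle_measure :: "(real \<times> complex) measure" where
  "time_circle_measure \<equiv> lborel \<Otimes>\<^sub>M circle_measure"

lemma AE_time_circle_norm: "AE p in time_circle_measure. norm (snd p) = 1"
proof (rule lborel_circle.AE_pair_measure)
  show "{p \<in> space time_circle_measure. norm (snd p) = 1} \<in> sets time_circle_measure"
    by measurable
  show "AE s in lborel. AE z in circle_measure. norm (snd (s, z)) = 1"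
    using AE_circle_norm by simp
qed

definition control_extension :: "complex set \<Rightarrow> real \<Rightarrow> (real \<times> complex \<Rightarrow> complex) \<Rightarrow> real \<times> complex \<Rightarrow> complex" where
  "control_extension \<omega> T u p = indicator ({0..T} \<times> \<omega>) p *\<^sub>R u p"

lemma control_extension_eq_0: "p \<notin> {0..T} \<times> \<omega> \<Longrightarrow> control_extension \<omega> T u p = 0"
  by (simp add: control_extension_def)

lemma
  assumes "u \<in> control_L2 \<omega> T"
  shows measurable_control_extension [measurable]:
      "control_extension \<omega> T u \<in> borel_measurable time_circle_measure"
    and integrable_control_extension_norm_square:
      "integrable time_circle_measure (\<lambda>p. (norm (control_extension \<omega> T u p))\<^sup>2)"
proof -
  show "control_extension \<omega> T u \<in> borel_measurable time_circle_measure"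
    using assms by (simp add: control_L2_def set_borel_measurable_def control_extension_def[abs_def])
  have "integrable time_circle_measure (\<lambda>p. indicator ({0..T} \<times> \<omega>) p *\<^sub>R (norm (u p))\<^sup>2)"
    using assms by (simp add: control_L2_def set_integrable_def)
  also have "(\<lambda>p. indicator ({0..T} \<times> \<omega>) p *\<^sub>R (norm (u p))\<^sup>2) = (\<lambda>p. (norm (control_extension \<omega> T u p))\<^sup>2)"
    by (auto simp: control_extension_def indicator_def)
  finally show "integrable time_circle_measure (\<lambda>p. (norm (control_extension \<omega> T u p))\<^sup>2)" .
qed

lemma integrable_time_strip: "integrable time_circle_measure (indicat_real ({0..T} \<times> UNIV))"
proof (rule integrable_real_indicator)
  show "{0..T} \<times> UNIV \<in> sets time_circle_measure"
    by (intro pair_measureI) auto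
  have "emeasure time_circle_measure ({0..T} \<times> UNIV) = emeasure lborel {0..T} * emeasure circle_measure UNIV"
    by (rule circle.emeasure_pair_measure_Times) auto
  also have "\<dots> < \<infinity>"
    by (cases "0 \<le> T") (simp_all add: emeasure_circle_measure ennreal_mult_less_top)
  finally show "emeasure time_circle_measure ({0..T} \<times> UNIV) < \<infinity>" .
qed

text \<open>The strip of times in \<open>{0..T}\<close> has finite measure, so square integrability
  there gives integrability through \<open>x \<le> 1 + x\<^sup>2\<close>.\<close>

lemma integrable_control_extension:
  assumes "u \<in> control_L2 \<omega> T"
  shows "integrable time_circle_measure (control_extension \<omega> T u)"
proof (rule Bochner_Integration.integrable_bound)
  show "integrable time_circle_measure
      (\<lambda>p. indicat_real ({0..T} \<times> UNIV) p + (norm (control_extension \<omega> T u p))\<^sup>2)"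
    by (intro Bochner_Integration.integrable_add integrable_time_strip integrable_control_extension_norm_square assms)
  show "AE p in time_circle_measure. norm (control_extension \<omega> T u p)
      \<le> norm (indicat_real ({0..T} \<times> UNIV) p + (norm (control_extension \<omega> T u p))\<^sup>2)"
  proof (rule AE_I2)
    fix p
    have "p \<notin> {0..T} \<times> UNIV \<Longrightarrow> p \<notin> {0..T} \<times> \<omega>" by auto
    moreover have "x \<le> 1 + x\<^sup>2" for x :: real
      using sum_power2_ge_zero[of "x - 1/2" 0] by (simp add: power2_eq_square algebra_simps)
    ultimately show "norm (control_extension \<omega> T u p)
      \<le> norm (indicat_real ({0..T} \<times> UNIV) p + (norm (control_extension \<omega> T u p))\<^sup>2)"
      by (cases "p \<in> {0..T} \<times> UNIV") (auto simp: control_extension_eq_0)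
  qed
qed (use assms in measurable)

text \<open>The bound on \<open>w\<close> is asked only where the extended control can be nonzero,
  up to a null set; a weight such as \<open>exp (n * s)\<close> is unbounded on the whole
  line.\<close>

lemma integrable_control_extension_mult:
  assumes u: "u \<in> control_L2 \<omega> T" and [measurable]: "w \<in> borel_measurable time_circle_measure"
    and bound: "\<And>s z. s \<in> {0..T} \<Longrightarrow> norm z = 1 \<Longrightarrow> norm (w (s, z)) \<le> B"
  shows "integrable time_circle_measure (\<lambda>p. control_extension \<omega> T u p * w p)"
proof (rule Bochner_Integration.integrable_bound)
  note [measurable] = measurable_control_extension[OF u]
  show "integrable time_circle_measure (\<lambda>p. B * norm (control_extension \<omega> T u p))"
    using integrable_control_extension[OF u] by simp
  show "AE p in time_circle_measure. norm (control_extension \<omega> T u p * w p)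
      \<le> norm (B * norm (control_extension \<omega> T u p))"
    using AE_time_circle_norm
  proof eventually_elim
    fix p :: "real \<times> complex" assume p: "norm (snd p) = 1"
    show "norm (control_extension \<omega> T u p * w p) \<le> norm (B * norm (control_extension \<omega> T u p))"
    proof (cases "fst p \<in> {0..T}")
      case True
      then have "norm (w p) \<le> B" using bound[of "fst p" "snd p"] p by simp
      then have "norm (w p) \<le> \<bar>B\<bar>" by simp
      then show ?thesis by (simp add: norm_mult abs_mult mult.commute mult_right_mono)
    qed (auto simp: control_extension_eq_0 mem_Times_iff)
  qed
  show "(\<lambda>p. control_extension \<omega> T u p * w p) \<in> borel_measurable time_circle_measure" by measurable
qed

text \<open>On the \<open>n\<close>-th coefficient of the Duhamel formula the projector acts as the
  identity and the semigroup as \<open>exp (- (n * (T - s)))\<close>. Cancelling the common factor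
  \<open>exp (- (n * T))\<close> leaves the weight \<open>exp (n * s)\<close>, and Fubini merges the
  two integrals.\<close>

lemma final_state_eq_0_imp_fourier_coeff:
  assumes T: "0 < T" and u: "u \<in> control_L2 \<omega> T" and zero: "final_state \<omega> T f u = 0"
  shows "(\<forall>n::nat. fourier_coeff f (int n) = 0) \<or>
    (\<forall>n::nat. fourier_coeff f (int n) = - 1 / (2 * pi) *
      (LINT p|time_circle_measure. control_extension \<omega> T u p * (of_real (exp (n * fst p)) * snd p powi (- int n))))"
proof -
  define v where "v = control_extension \<omega> T u"
  note [measurable] = measurable_control_extension[OF u, folded v_def]
  define h where "h s = half_heat_semigroup (T - s) (riesz_projector (to_L2 (\<lambda>z. indicator \<omega> z * u (s, z))))" for s
  have eq: "half_heat_semigroup T f + (LINT s:{0..T}|lborel. h s) = 0"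
    using zero by (simp add: final_state_def h_def)
  have fT: "fourier_coeff (half_heat_semigroup T f) (int n) = fourier_coeff f (int n) * of_real (exp (- (n * T)))" for n :: nat
    using T by (simp add: fourier_coeff_half_heat_semigroup)
  show ?thesis
  proof (cases "set_integrable lborel {0..T} h")
    case False
    \<comment> \<open>The Bochner integral is then \<open>0\<close> by convention, so that \<open>f\<close> has no nonnegative frequencies.\<close>
    then have "half_heat_semigroup T f = 0"
      using eq by (simp add: set_integrable_def set_lebesgue_integral_def not_integrable_integral_eq)
    moreover have "fourier_coeff 0 n = 0" for n
      using bounded_linear.linear[OF bounded_linear_fourier_coeff[of n]] by (rule linear_0)
    ultimately show ?thesis using fT by simp
  next
    case True
    \<comment> \<open>For the remaining null set of times \<open>to_L2\<close> returns its default
      \<open>0\<close>, so the coefficient formula \<open>hs\<close> is claimed almost everywhere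
      only.\<close>
    have slice: "AE s in lborel. square_integrable (\<lambda>z. v (s, z))"
      using lborel_circle.AE_integrable_fst'[OF integrable_control_extension_norm_square[OF u, folded v_def]]
    proof eventually_elim
      fix s assume "integrable circle_measure (\<lambda>z. (norm (v (s, z)))\<^sup>2)"
      then show "square_integrable (\<lambda>z. v (s, z))"
        unfolding square_integrable_def by simp
    qed
    have "fourier_coeff f (int n) = - 1 / (2 * pi) *
      (LINT p|time_circle_measure. v p * (of_real (exp (n * fst p)) * snd p powi (- int n)))" for n :: nat
    proof -
      define w where "w p = complex_of_real (exp (n * fst p)) * snd p powi (- int n)" for p :: "real \<times> complex"
      have [measurable]: "w \<in> borel_measurable time_circle_measure"
        unfolding w_def[abs_def] power_int_minus power_int_of_nat by measurable
      have "norm (w (s, z)) \<le> exp (n * T)" if "s \<in> {0..T}" "norm z = 1" for s z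
        using that by (simp add: w_def norm_mult norm_power_int mult_left_mono)
      then have int: "integrable time_circle_measure (\<lambda>p. v p * w p)"
        unfolding v_def by (intro integrable_control_extension_mult[OF u]) auto
      have hs: "AE s in lborel. fourier_coeff (indicat_real {0..T} s *\<^sub>R h s) (int n)
          = of_real (exp (- (n * T))) / (2 * pi) * (LINT z|circle_measure. v (s, z) * w (s, z))"
        using slice
      proof eventually_elim
        fix s assume sq: "square_integrable (\<lambda>z. v (s, z))"
        interpret fc: bounded_linear "\<lambda>f. fourier_coeff f (int n)" by (rule bounded_linear_fourier_coeff)
        show "fourier_coeff (indicat_real {0..T} s *\<^sub>R h s) (int n)
          = of_real (exp (- (n * T))) / (2 * pi) * (LINT z|circle_measure. v (s, z) * w (s, z))"
        proof (cases "s \<in> {0..T}")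
          case True
          then have vs: "(\<lambda>z. indicator \<omega> z * u (s, z)) = (\<lambda>z. v (s, z))"
            by (auto simp: v_def control_extension_def indicator_def)
          have "fourier_coeff (h s) (int n) =
              1 / (2 * pi) * (LINT z|circle_measure. v (s, z) * z powi (- int n)) * of_real (exp (- (n * (T - s))))"
            using True sq
            by (simp add: h_def vs fourier_coeff_half_heat_semigroup fourier_coeff_riesz_projector fourier_coeff_to_L2)
          also have "of_real (exp (- (n * (T - s)))) = of_real (exp (- (n * T))) * complex_of_real (exp (n * s))"
            by (simp add: of_real_mult[symmetric] exp_add[symmetric] algebra_simps del: of_real_mult)
          also have "1 / (2 * pi) * (LINT z|circle_measure. v (s, z) * z powi (- int n))
              * (of_real (exp (- (n * T))) * complex_of_real (exp (n * s)))
              = of_real (exp (- (n * T))) / (2 * pi) *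
                (complex_of_real (exp (n * s)) * (LINT z|circle_measure. v (s, z) * z powi (- int n)))"
            by (simp add: mult_ac)
          also have "complex_of_real (exp (n * s)) * (LINT z|circle_measure. v (s, z) * z powi (- int n))
              = (LINT z|circle_measure. v (s, z) * w (s, z))"
            unfolding w_def by (subst integral_mult_right_zero[symmetric]) (simp add: mult_ac)
          finally show ?thesis using True by simp
        next
          case False
          then have "v (s, z) = 0" for z by (auto simp: v_def control_extension_eq_0)
          with False show ?thesis by (simp add: fc.zero)
        qed
      qed
      have "0 = fourier_coeff (half_heat_semigroup T f + (LINT s:{0..T}|lborel. h s)) (int n)"
        using linear_0[OF bounded_linear.linear[OF bounded_linear_fourier_coeff[of n]]] by (simp add: eq)
      also have "\<dots> = fourier_coeff f (int n) * of_real (exp (- (n * T)))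
          + fourier_coeff (LINT s:{0..T}|lborel. h s) (int n)"
        using linear_add[OF bounded_linear.linear[OF bounded_linear_fourier_coeff[of n]]] by (simp add: fT)
      also have "fourier_coeff (LINT s:{0..T}|lborel. h s) (int n)
          = (LINT s|lborel. fourier_coeff (indicat_real {0..T} s *\<^sub>R h s) (int n))"
        using True unfolding set_integrable_def set_lebesgue_integral_def
        by (intro integral_bounded_linear[OF bounded_linear_fourier_coeff, symmetric])
      also have "\<dots> = (LINT s|lborel. of_real (exp (- (n * T))) / (2 * pi) * (LINT z|circle_measure. v (s, z) * w (s, z)))"
      proof (rule integral_cong_AE)
        \<comment> \<open>Integrability of \<open>h\<close> also supplies the measurability in
          \<open>s\<close> that the congruence rule asks for.\<close>
        have "integrable lborel (\<lambda>s. fourier_coeff (indicat_real {0..T} s *\<^sub>R h s) (int n))"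
          using True unfolding set_integrable_def
          by (rule integrable_bounded_linear[OF bounded_linear_fourier_coeff])
        then show "(\<lambda>s. fourier_coeff (indicat_real {0..T} s *\<^sub>R h s) (int n)) \<in> borel_measurable lborel"
          by (rule borel_measurable_integrable)
      qed (use hs in \<open>simp_all add: circle.borel_measurable_lebesgue_integral\<close>)
      also have "\<dots> = of_real (exp (- (n * T))) / (2 * pi) * (LINT p|time_circle_measure. v p * w p)"
        by (subst integral_mult_right_zero, subst lborel_circle.integral_fst'[OF int]) simp
      finally have "of_real (exp (- (n * T))) *
          (fourier_coeff f (int n) + 1 / (2 * pi) * (LINT p|time_circle_measure. v p * w p)) = 0"
        by (simp add: algebra_simps)
      then have "fourier_coeff f (int n) + 1 / (2 * pi) * (LINT p|time_circle_measure. v p * w p) = 0"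
        by (simp only: mult_eq_0_iff of_real_eq_0_iff exp_not_eq_zero simp_thms)
      then show ?thesis by (simp add: w_def eq_neg_iff_add_eq_0)
    qed
    then show ?thesis by (simp add: v_def)
  qed
qed

section \<open>Cauchy transforms\<close>

text \<open>This is the Cauchy transform of the complex measure obtained by pushing the density
  \<open>g\<close> forward along \<open>q\<close>; keeping \<open>g\<close> and \<open>q\<close>
  apart avoids complex measures.\<close>

definition cauchy_transform :: "'a measure \<Rightarrow> ('a \<Rightarrow> complex) \<Rightarrow> ('a \<Rightarrow> complex) \<Rightarrow> complex \<Rightarrow> complex" where
  "cauchy_transform M g q z = (LINT p|M. g p / (q p - z))"

text \<open>Wherever \<open>g\<close> does not vanish, the geometric expansion of
  \<open>1 / (q p - z)\<close> in powers of \<open>z - z0\<close> has ratio of modulus at most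
  \<open>norm (z - z0) / \<delta>\<close>, which is below \<open>1\<close>. This uniform bound and
  the integrability of \<open>g\<close> justify integrating term by term.\<close>

lemma cauchy_transform_sums:
  assumes g: "integrable M g" and q: "q \<in> borel_measurable M"
    and away: "\<And>p. g p \<noteq> 0 \<Longrightarrow> \<delta> \<le> norm (q p - z0)"
    and z: "norm (z - z0) < \<delta>"
  shows "(\<lambda>n. (LINT p|M. g p / (q p - z0) ^ Suc n) * (z - z0) ^ n) sums cauchy_transform M g q z"
proof -
  have \<delta>: "0 < \<delta>" using z norm_ge_zero[of "z - z0"] by linarith
  have [measurable]: "g \<in> borel_measurable M" "q \<in> borel_measurable M"
    using g q by auto
  define r where "r = norm (z - z0) / \<delta>"
  have r: "0 \<le> r" "r < 1" using z \<delta> by (auto simp: r_def)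
  define f where "f n p = g p / (q p - z0) ^ Suc n * (z - z0) ^ n" for n p
  have [measurable]: "f n \<in> borel_measurable M" for n
    unfolding f_def[abs_def] by measurable
  have f_le: "norm (f n p) \<le> norm (g p) / \<delta> * r ^ n" for n p
  proof (cases "g p = 0")
    case False
    then have "\<delta> ^ Suc n \<le> norm (q p - z0) ^ Suc n"
      using \<delta> by (intro power_mono away) auto
    then have "norm (g p) * norm (z - z0) ^ n / norm (q p - z0) ^ Suc n
        \<le> norm (g p) * norm (z - z0) ^ n / \<delta> ^ Suc n"
      using \<delta> less_le_trans[OF \<delta> away[OF False]]
      by (intro divide_left_mono mult_pos_pos zero_less_power) auto
    then show ?thesis
      by (simp add: f_def r_def norm_mult norm_divide norm_power power_divide)
  qed (simp add: f_def)
  have int_bound: "integrable M (\<lambda>p. norm (g p) / \<delta> * r ^ n)" for n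
    using g by simp
  have int: "integrable M (f n)" for n
    by (rule Bochner_Integration.integrable_bound[OF int_bound[of n]])
      (use f_le \<delta> r in \<open>auto simp: abs_mult\<close>)
  have "(\<lambda>n. integral\<^sup>L M (f n)) sums (LINT p|M. (\<Sum>n. f n p))"
  proof (rule sums_integral[OF int])
    have geo: "summable (\<lambda>n. C * r ^ n)" for C
      using r by (intro summable_mult summable_geometric) auto
    show "AE p in M. summable (\<lambda>n. norm (f n p))"
    proof (rule AE_I2)
      fix p
      show "summable (\<lambda>n. norm (f n p))"
        by (rule summable_comparison_test'[OF geo[of "norm (g p) / \<delta>"], of 0]) (use f_le in simp)
    qed
    have "norm (LINT p|M. norm (f n p)) \<le> (LINT p|M. norm (g p) / \<delta>) * r ^ n" for n
    proof -
      have "(LINT p|M. norm (f n p)) \<le> (LINT p|M. norm (g p) / \<delta> * r ^ n)"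
        using f_le int int_bound by (intro integral_mono) auto
      then show ?thesis by simp
    qed
    then show "summable (\<lambda>n. LINT p|M. norm (f n p))"
      by (rule summable_comparison_test'[OF geo, of 0])
  qed
  moreover have "(\<Sum>n. f n p) = g p / (q p - z)" for p
  proof (cases "g p = 0")
    case False
    define x where "x = (z - z0) / (q p - z0)"
    have q0: "q p - z0 \<noteq> 0" using away[OF False] \<delta> by auto
    have qz: "q p - z \<noteq> 0" using away[OF False] z by auto
    have "norm (z - z0) < norm (q p - z0)" using away[OF False] z by simp
    then have "norm x < 1" using q0 by (simp add: x_def norm_divide)
    then have "(\<lambda>n. g p / (q p - z0) * x ^ n) sums (g p / (q p - z0) * (1 / (1 - x)))"
      by (intro sums_mult geometric_sums)
    moreover have "g p / (q p - z0) * x ^ n = f n p" for n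
      by (simp add: f_def x_def power_divide)
    moreover have "g p / (q p - z0) * (1 / (1 - x)) = g p / (q p - z)"
    proof -
      have "1 - x = (q p - z) / (q p - z0)" using q0 by (simp add: x_def diff_divide_distrib[symmetric] field_simps)
      then show ?thesis using q0 by simp
    qed
    ultimately show ?thesis by (simp add: sums_iff)
  qed (simp add: f_def)
  moreover have "integral\<^sup>L M (f n) = (LINT p|M. g p / (q p - z0) ^ Suc n) * (z - z0) ^ n" for n
    unfolding f_def by (rule integral_mult_left_zero)
  ultimately show ?thesis by (simp add: cauchy_transform_def)
qed

text \<open>Each point of the open set \<open>- K\<close> is the centre of a ball on which the
  preceding expansion converges.\<close>

lemma holomorphic_on_cauchy_transform:
  assumes g: "integrable M g" and q: "q \<in> borel_measurable M"
    and K: "closed K" "\<And>p. g p \<noteq> 0 \<Longrightarrow> q p \<in> K"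
  shows "cauchy_transform M g q holomorphic_on - K"
proof -
  have "cauchy_transform M g q field_differentiable at z" if z: "z \<in> - K" for z
  proof -
    obtain \<delta> where \<delta>: "\<delta> > 0" "ball z \<delta> \<subseteq> - K"
      using K(1) z by (auto simp: closed_def elim: openE)
    have "cauchy_transform M g q holomorphic_on ball z \<delta>"
    proof (rule power_series_holomorphic)
      fix w assume w: "w \<in> ball z \<delta>"
      show "(\<lambda>n. (LINT p|M. g p / (q p - z) ^ Suc n) * (w - z) ^ n) sums cauchy_transform M g q w"
      proof (rule cauchy_transform_sums[OF g q])
        show "norm (w - z) < \<delta>" using w by (simp add: dist_norm norm_minus_commute)
        fix p assume "g p \<noteq> 0"
        then have "q p \<notin> ball z \<delta>" using K(2) \<delta>(2) by auto
        then show "\<delta> \<le> norm (q p - z)" by (simp add: dist_norm norm_minus_commute)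
      qed
    qed
    then show ?thesis using \<delta>(1) by (auto intro: holomorphic_on_imp_differentiable_at)
  qed
  then show ?thesis by (simp add: holomorphic_on_def field_differentiable_at_within)
qed

text \<open>The substitution \<open>1 / z\<close> moves infinity to the origin, where the transform
  can again be expanded in a power series; the factor \<open>1 / z\<close> is the source of the zero
  at infinity.\<close>

lemma cauchy_transform_inversion:
  assumes "z \<noteq> 0" "\<And>p. g p \<noteq> 0 \<Longrightarrow> q p \<noteq> 0"
  shows "cauchy_transform M g q z
    = - (1 / z) * cauchy_transform M (\<lambda>p. g p / q p) (\<lambda>p. 1 / q p) (1 / z)"
proof -
  have "g p / (q p - z) = - (1 / z) * (g p / q p / (1 / q p - 1 / z))" for p
  proof (cases "g p = 0")
    case False
    \<comment> \<open>When \<open>q p = z\<close>, both sides are \<open>0\<close> by the convention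
      for division by zero.\<close>
    then show ?thesis using assms by (cases "q p = z") (auto simp: field_simps)
  qed simp
  then have "cauchy_transform M g q z = (LINT p|M. - (1 / z) * (g p / q p / (1 / q p - 1 / z)))"
    unfolding cauchy_transform_def by (simp only:)
  also have "\<dots> = - (1 / z) * cauchy_transform M (\<lambda>p. g p / q p) (\<lambda>p. 1 / q p) (1 / z)"
    unfolding cauchy_transform_def by (rule integral_mult_right_zero)
  finally show ?thesis .
qed

section \<open>Area integrals over the exterior of the disk\<close>

no_notation fps_nth (infixl \<open>$\<close> 75)

text \<open>The library has the invariance of Lebesgue measure under orthogonal maps only on \<open>real ^ 'n\<close>.\<close>

lemma lborel_complex_eq_distr_vec:
  "(lborel :: complex measure) = distr (lborel :: (real^2) measure) borel (\<lambda>v. Complex (v$1) (v$2))"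
proof (rule lborel_eqI)
  fix l u :: complex
  assume lu: "\<And>b. b \<in> Basis \<Longrightarrow> l \<bullet> b \<le> u \<bullet> b"
  let ?l = "vector [Re l, Im l] :: real^2" and ?u = "vector [Re u, Im u] :: real^2"
  have m: "(\<lambda>v::real^2. Complex (v$1) (v$2)) \<in> borel_measurable lborel"
    unfolding Complex_eq by simp
  have "(\<lambda>v::real^2. Complex (v$1) (v$2)) -` box l u = box ?l ?u"
    by (auto simp: mem_box_cart forall_2 in_box_complex_iff)
  then have "emeasure (distr (lborel :: (real^2) measure) borel (\<lambda>v. Complex (v$1) (v$2))) (box l u)
      = emeasure lborel (box ?l ?u)"
    using m by (subst emeasure_distr) auto
  also have "\<dots> = (\<Prod>b\<in>Basis. (?u - ?l) \<bullet> b)"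
  proof (rule emeasure_lborel_box)
    have "?l $ i \<le> ?u $ i" for i
      using lu[of 1] lu[of \<i>] exhaust_2[of i] by (auto simp: Basis_complex_def)
    then show "?l \<bullet> b \<le> ?u \<bullet> b" if "b \<in> Basis" for b
      using that by (auto simp: Basis_vec_def inner_axis)
  qed
  also have "(\<Prod>b\<in>Basis. (?u - ?l) \<bullet> b) = (Re u - Re l) * (Im u - Im l)"
    by (simp add: Basis_vec_def UNION_singleton_eq_range prod.reindex inj_on_def axis_eq_axis inner_axis UNIV_2)
  also have "\<dots> = (\<Prod>b\<in>Basis. (u - l) \<bullet> b)"
    by (simp add: Basis_complex_def)
  finally show "emeasure (distr (lborel :: (real^2) measure) borel (\<lambda>v. Complex (v$1) (v$2))) (box l u)
      = ennreal (\<Prod>b\<in>Basis. (u - l) \<bullet> b)" .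
qed simp

lemma lborel_distr_rotation:
  fixes c :: complex
  assumes "norm c = 1"
  shows "distr lborel borel (\<lambda>z. c * z) = lborel"
proof (rule lborel_eqI[symmetric])
  fix l u :: complex
  assume lu: "\<And>b. b \<in> Basis \<Longrightarrow> l \<bullet> b \<le> u \<bullet> b"
  define T where "T v = Complex (v$1) (v$2)" for v :: "real^2"
  define U where "U z = (vector [Re z, Im z] :: real^2)" for z
  \<comment> \<open>\<open>f\<close> is the inverse rotation in real coordinates: the preimage of a
    box under multiplication by \<open>c\<close> corresponds to its image under \<open>f\<close>,
    and invariance under orthogonal maps is available for images.\<close>
  define f where "f v = U (inverse c * T v)" for v
  have TU: "T (U z) = z" and UT: "U (T v) = v" for z v
    by (simp_all add: T_def U_def vec_eq_iff forall_2)
  have c: "c \<noteq> 0" using assms by auto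
  have Tm: "T \<in> borel_measurable borel"
    unfolding T_def Complex_eq by simp
  have normU: "norm (U z) = norm z" for z
    by (simp add: U_def norm_vec_def L2_set_def sum_2 cmod_def)
  have orth: "orthogonal_transformation f"
    unfolding orthogonal_transformation
  proof
    have "T (x + y) = T x + T y" "U (z + w) = U z + U w" "T (r *\<^sub>R x) = r *\<^sub>R T x" "U (r *\<^sub>R z) = r *\<^sub>R U z"
      for x y z w r
      by (simp_all add: T_def U_def complex_eq_iff vec_eq_iff forall_2)
    then show "linear f"
      unfolding f_def by (intro linearI) (simp_all only: distrib_left mult_scaleR_right)
    show "\<forall>v. norm (f v) = norm v"
    proof
      fix v
      have "norm v = norm (T v)" using normU[of "T v"] by (simp add: UT)
      then show "norm (f v) = norm v" using assms by (simp add: f_def normU norm_mult norm_inverse)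
    qed
  qed
  have box: "T -` box l u \<in> lmeasurable"
  proof -
    have "T -` box l u = box (U l) (U u)"
      by (auto simp: T_def U_def mem_box_cart forall_2 in_box_complex_iff)
    then show ?thesis by simp
  qed
  have "T -` ((\<lambda>z. c * z) -` box l u) = f ` (T -` box l u)"
  proof (intro set_eqI iffI)
    fix v assume "v \<in> T -` ((\<lambda>z. c * z) -` box l u)"
    moreover have "v = f (U (c * T v))" using c by (simp add: f_def TU UT mult.assoc[symmetric])
    ultimately show "v \<in> f ` (T -` box l u)" by (auto simp: TU)
  next
    fix v assume "v \<in> f ` (T -` box l u)"
    then obtain w where w: "T w \<in> box l u" "v = f w" by auto
    have "c * T (f w) = T w" using c by (simp add: f_def TU)
    with w show "v \<in> T -` ((\<lambda>z. c * z) -` box l u)" by simp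
  qed
  moreover have "emeasure lebesgue (f ` (T -` box l u)) = emeasure lebesgue (T -` box l u)"
    unfolding emeasure_eq_measure2[OF box] emeasure_eq_measure2[OF measurable_orthogonal_image[OF orth box]]
    by (simp only: measure_orthogonal_image[OF orth box])
  ultimately have eq: "emeasure lebesgue (T -` ((\<lambda>z. c * z) -` box l u)) = emeasure lebesgue (T -` box l u)"
    by (simp only:)
  have Tb: "emeasure lborel A = emeasure lebesgue (T -` A)" if "A \<in> sets borel" for A
  proof -
    have "emeasure lborel A = emeasure (distr lborel borel T) A"
      unfolding T_def by (subst lborel_complex_eq_distr_vec) simp
    also have "\<dots> = emeasure lborel (T -` A)"
      using that Tm by (simp add: emeasure_distr)
    also have "\<dots> = emeasure lebesgue (T -` A)"
      using measurable_sets_borel[OF Tm that] by simp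
    finally show ?thesis .
  qed
  have cb: "(\<lambda>z. c * z) -` box l u \<in> sets borel"
    by (intro measurable_sets_borel[of _ borel]) auto
  have "emeasure (distr lborel borel ((*) c)) (box l u) = emeasure lborel ((\<lambda>z. c * z) -` box l u)"
    by (simp add: emeasure_distr)
  also have "\<dots> = emeasure lborel (box l u)"
    using eq by (simp add: Tb cb)
  also have "\<dots> = (\<Prod>b\<in>Basis. (u - l) \<bullet> b)"
    using lu by (rule emeasure_lborel_box)
  finally show "emeasure (distr lborel borel ((*) c)) (box l u) = ennreal (\<Prod>b\<in>Basis. (u - l) \<bullet> b)" .
qed simp

text \<open>Tonelli exchanges the integrals; each rotate of \<open>f\<close> has the same integral
  over the plane, and the circle has length \<open>2 * pi\<close>.\<close>

lemma nn_integral_circle_average: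
  fixes f :: "complex \<Rightarrow> ennreal"
  assumes [measurable]: "f \<in> borel_measurable borel"
  shows "(\<integral>\<^sup>+z. (\<integral>\<^sup>+\<zeta>. f (\<zeta> * z) \<partial>circle_measure) \<partial>lborel) = ennreal (2 * pi) * (\<integral>\<^sup>+z. f z \<partial>lborel)"
proof -
  have "(\<integral>\<^sup>+z. (\<integral>\<^sup>+\<zeta>. f (\<zeta> * z) \<partial>circle_measure) \<partial>lborel)
      = (\<integral>\<^sup>+\<zeta>. (\<integral>\<^sup>+z. f (\<zeta> * z) \<partial>lborel) \<partial>circle_measure)"
    by (rule lborel_circle.Fubini'[symmetric]) simp
  also have "\<dots> = (\<integral>\<^sup>+\<zeta>. (\<integral>\<^sup>+z. f z \<partial>lborel) \<partial>circle_measure)"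
  proof (rule nn_integral_cong_AE)
    show "AE \<zeta> in circle_measure. (\<integral>\<^sup>+z. f (\<zeta> * z) \<partial>lborel) = (\<integral>\<^sup>+z. f z \<partial>lborel)"
      using AE_circle_norm
    proof eventually_elim
      fix \<zeta> :: complex assume "norm \<zeta> = 1"
      from lborel_distr_rotation[OF this] show "(\<integral>\<^sup>+z. f (\<zeta> * z) \<partial>lborel) = (\<integral>\<^sup>+z. f z \<partial>lborel)"
        using nn_integral_distr[of "(*) \<zeta>" lborel borel f] by simp
    qed
  qed
  also have "\<dots> = ennreal (2 * pi) * (\<integral>\<^sup>+z. f z \<partial>lborel)"
    by (simp add: emeasure_circle_measure mult.commute)
  finally show ?thesis .
qed

section \<open>Integrals of inverse powers and Laurent series outside the disk\<close>

lemma tendsto_inverse_power_at_top: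
  "0 < n \<Longrightarrow> ((\<lambda>r::real. C / r ^ n) \<longlongrightarrow> 0) at_top"
  by (intro real_tendsto_divide_at_top[OF tendsto_const] filterlim_pow_at_top filterlim_ident)

lemma has_real_derivative_divide_power:
  "r \<noteq> 0 \<Longrightarrow> ((\<lambda>r. C / r ^ n) has_real_derivative - (n * C) / r ^ Suc n) (at r)"
proof (cases n)
  case (Suc k)
  assume r: "r \<noteq> 0"
  have "((\<lambda>r. C / r ^ n) has_real_derivative (0 * r ^ n - C * (n * r ^ (n - Suc 0))) / (r ^ n * r ^ n)) (at r)"
    using r by (intro DERIV_divide DERIV_const DERIV_pow) simp
  moreover have "(0 * r ^ n - C * (n * r ^ (n - Suc 0))) / (r ^ n * r ^ n) = - (n * C) / r ^ Suc n"
    using r by (simp add: Suc field_simps)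
  ultimately show ?thesis by simp
qed simp

lemma nn_integral_exterior_norm_power:
  fixes m :: nat
  assumes "2 \<le> m"
  shows "(\<integral>\<^sup>+z\<in>{z::complex. 1 < norm z}. ennreal (1 / norm z ^ (2 * m)) \<partial>lborel) = ennreal (pi / (m - 1))"
proof -
  \<comment> \<open>Layer-cake formula: write \<open>|z|\<close> to the power \<open>- 2m\<close> as the integral of \<open>h\<close> over \<open>r \<ge> |z|\<close> and exchange the integrals.\<close>
  define h where "h r = 2 * m / r ^ (2 * m + 1)" for r :: real
  have [measurable]: "h \<in> borel_measurable borel" unfolding h_def by simp
  have tail: "(\<integral>\<^sup>+r. ennreal (h r) * indicator {a..} r \<partial>lborel) = ennreal (1 / a ^ (2 * m))" if "1 \<le> a" for a
  proof -
    have "(\<integral>\<^sup>+r. ennreal (h r) * indicator {a..} r \<partial>lborel) = ennreal (0 - (- 1 / a ^ (2 * m)))"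
    proof (rule nn_integral_FTC_atLeast)
      fix r assume r: "a \<le> r"
      have "r \<noteq> 0" using r that by simp
      then show "((\<lambda>r::real. - 1 / r ^ (2 * m)) has_real_derivative h r) (at r)"
        using assms unfolding h_def
        by (auto intro!: derivative_eq_intros simp: field_simps power_diff power_add power2_eq_square)
      show "0 \<le> h r" using r that by (simp add: h_def)
    next
      show "((\<lambda>r::real. - 1 / r ^ (2 * m)) \<longlongrightarrow> 0) at_top"
        by (rule tendsto_inverse_power_at_top) (use assms in simp)
    qed simp
    then show ?thesis by simp
  qed
  have area: "emeasure lborel {z::complex. 1 < norm z \<and> norm z \<le> r} = ennreal (pi * (r\<^sup>2 - 1))"
    if "1 \<le> r" for r
  proof -
    have "{z::complex. 1 < norm z \<and> norm z \<le> r} = cball 0 r - cball 0 1" by auto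
    then have "emeasure lborel {z::complex. 1 < norm z \<and> norm z \<le> r}
        = emeasure lborel (cball (0::complex) r - cball 0 1)"
      by simp
    also have "\<dots> = emeasure lborel (cball (0::complex) r) - emeasure lborel (cball (0::complex) 1)"
      using that by (intro emeasure_Diff) (auto simp: emeasure_cball)
    also have "\<dots> = ennreal (pi * (r\<^sup>2 - 1))"
      using that by (simp add: emeasure_cball unit_ball_vol_2 ennreal_minus algebra_simps)
    finally show ?thesis .
  qed
  have "(\<integral>\<^sup>+z\<in>{z::complex. 1 < norm z}. ennreal (1 / norm z ^ (2 * m)) \<partial>lborel)
      = (\<integral>\<^sup>+z. (\<integral>\<^sup>+r. ennreal (h r) * indicator {z. 1 < norm z \<and> norm z \<le> r} z \<partial>lborel) \<partial>(lborel :: complex measure))"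
  proof (rule nn_integral_cong)
    fix z :: complex
    show "ennreal (1 / norm z ^ (2 * m)) * indicator {z. 1 < norm z} z
        = (\<integral>\<^sup>+r. ennreal (h r) * indicator {z. 1 < norm z \<and> norm z \<le> r} z \<partial>lborel)"
    proof (cases "1 < norm z")
      case True
      then have "(\<integral>\<^sup>+r. ennreal (h r) * indicator {z. 1 < norm z \<and> norm z \<le> r} z \<partial>lborel)
          = (\<integral>\<^sup>+r. ennreal (h r) * indicator {norm z..} r \<partial>lborel)"
        by (intro nn_integral_cong) (auto simp: indicator_def)
      with True tail[of "norm z"] show ?thesis by simp
    qed simp
  qed
  also have "\<dots> = (\<integral>\<^sup>+r. (\<integral>\<^sup>+z. ennreal (h r) * indicator {z::complex. 1 < norm z \<and> norm z \<le> r} z \<partial>lborel) \<partial>lborel)"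
  proof (rule lborel_pair.Fubini')
    have "(\<lambda>(r, z::complex). ennreal (h r) * indicator {p. 1 < norm (snd p) \<and> norm (snd p) \<le> fst p} (r, z))
        \<in> borel_measurable (lborel \<Otimes>\<^sub>M lborel)"
      by measurable
    then show "(\<lambda>(r, z::complex). ennreal (h r) * indicator {z. 1 < norm z \<and> norm z \<le> r} z)
        \<in> borel_measurable (lborel \<Otimes>\<^sub>M lborel)"
      by (simp add: indicator_def)
  qed
  also have "\<dots> = (\<integral>\<^sup>+r. ennreal (h r * (pi * (r\<^sup>2 - 1))) * indicator {1..} r \<partial>lborel)"
  proof (rule nn_integral_cong)
    fix r :: real
    have "(\<integral>\<^sup>+z. ennreal (h r) * indicator {z::complex. 1 < norm z \<and> norm z \<le> r} z \<partial>lborel)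
        = ennreal (h r) * (\<integral>\<^sup>+z. indicator {z::complex. 1 < norm z \<and> norm z \<le> r} z \<partial>lborel)"
      by (rule nn_integral_cmult) measurable
    also have "\<dots> = ennreal (h r * (pi * (r\<^sup>2 - 1))) * indicator {1..} r"
    proof (cases "1 \<le> r")
      case True
      then show ?thesis by (simp add: area ennreal_mult'[symmetric] h_def)
    next
      case False
      then have "{z::complex. 1 < norm z \<and> norm z \<le> r} = {}" by auto
      with False show ?thesis by simp
    qed
    finally show "(\<integral>\<^sup>+z. ennreal (h r) * indicator {z::complex. 1 < norm z \<and> norm z \<le> r} z \<partial>lborel)
        = ennreal (h r * (pi * (r\<^sup>2 - 1))) * indicator {1..} r" .
  qed
  \<comment> \<open>The integrand is \<open>2 * pi * m\<close> times the difference of the powers of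
    \<open>r\<close> with exponents \<open>1 - 2 * m\<close> and \<open>- 1 - 2 * m\<close>. For
    \<open>2 \<le> m\<close> both have a primitive that is an inverse power, vanishing at
    infinity.\<close>
  also have "\<dots> = ennreal (0 - (pi / 1 ^ (2 * m) - pi * m / (m - 1) / 1 ^ (2 * m - 2)))"
  proof (rule nn_integral_FTC_atLeast)
    fix r :: real assume r: "1 \<le> r"
    obtain k where k: "m = k + 2" using assms by (metis add.commute le_Suc_ex)
    have "r \<noteq> 0" using r by simp
    then have "((\<lambda>r. pi / r ^ (2 * m) - pi * m / (m - 1) / r ^ (2 * m - 2)) has_real_derivative
        - ((2 * m) * pi) / r ^ Suc (2 * m)
          - (- ((2 * m - 2) * (pi * m / (m - 1))) / r ^ Suc (2 * m - 2))) (at r)"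
      by (intro DERIV_diff has_real_derivative_divide_power)
    moreover have "- ((2 * m) * pi) / r ^ Suc (2 * m)
          - (- ((2 * m - 2) * (pi * m / (m - 1))) / r ^ Suc (2 * m - 2)) = h r * (pi * (r\<^sup>2 - 1))"
    proof -
      have "real (2 * m - 2) * (pi * m / (m - 1)) = 2 * pi * m"
        by (simp add: k field_simps)
      moreover have "r ^ Suc (2 * m) = r\<^sup>2 * r ^ Suc (2 * m - 2)"
        by (simp add: k power2_eq_square)
      ultimately show ?thesis
        using \<open>r \<noteq> 0\<close> by (simp add: h_def field_simps)
    qed
    ultimately show "((\<lambda>r. pi / r ^ (2 * m) - pi * m / (m - 1) / r ^ (2 * m - 2)) has_real_derivative
        h r * (pi * (r\<^sup>2 - 1))) (at r)"
      by metis
    show "0 \<le> h r * (pi * (r\<^sup>2 - 1))" using r by (simp add: h_def)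
  next
    show "((\<lambda>r. pi / r ^ (2 * m) - pi * m / (m - 1) / r ^ (2 * m - 2)) \<longlongrightarrow> 0) at_top"
      using tendsto_diff[OF tendsto_inverse_power_at_top[of "2 * m" pi]
          tendsto_inverse_power_at_top[of "2 * m - 2" "pi * m / (m - 1)"]] assms by simp
  qed simp
  also have "0 - (pi / 1 ^ (2 * m) - pi * m / (m - 1) / 1 ^ (2 * m - 2)) = pi / (m - 1)"
    using assms by (simp add: field_simps)
  finally show ?thesis .
qed

lemma nn_integral_exterior_laurent_sum:
  fixes a :: "nat \<Rightarrow> complex"
  shows
  "(\<integral>\<^sup>+z\<in>{z. 1 < norm z}. ennreal ((norm (\<Sum>n<N. a n / z ^ (n + 2)))\<^sup>2) \<partial>lborel)
    = ennreal (pi * (\<Sum>n<N. (norm (a n))\<^sup>2 / (n + 1)))"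
proof -
  \<comment> \<open>Averaging over rotations replaces polar coordinates: on each circle the powers of \<open>z\<close> are orthogonal.\<close>
  let ?E = "{z::complex. 1 < norm z}"
  define f where "f z = ennreal ((norm (\<Sum>n<N. a n / z ^ (n + 2)))\<^sup>2) * indicator ?E z" for z :: complex
  have [measurable]: "?E \<in> sets borel" by measurable
  have [measurable]: "f \<in> borel_measurable borel" unfolding f_def by measurable
  have avg: "(\<integral>\<^sup>+\<zeta>. f (\<zeta> * z) \<partial>circle_measure)
      = (\<Sum>n<N. ennreal (2 * pi * (norm (a n))\<^sup>2) * (ennreal (1 / norm z ^ (2 * (n + 2))) * indicator ?E z))" for z
  proof -
    define c where "c n = a n / z ^ (n + 2)" for n
    have "(\<integral>\<^sup>+\<zeta>. f (\<zeta> * z) \<partial>circle_measure)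
        = (\<integral>\<^sup>+\<zeta>. ennreal ((norm (\<Sum>n<N. c n * \<zeta> powi (- int (n + 2))))\<^sup>2) * indicator ?E z \<partial>circle_measure)"
    proof (rule nn_integral_cong_AE)
      show "AE \<zeta> in circle_measure. f (\<zeta> * z)
          = ennreal ((norm (\<Sum>n<N. c n * \<zeta> powi (- int (n + 2))))\<^sup>2) * indicator ?E z"
        using AE_circle_norm
      proof eventually_elim
        fix \<zeta> :: complex assume "norm \<zeta> = 1"
        moreover have "a n / (\<zeta> * z) ^ (n + 2) = c n * \<zeta> powi (- int (n + 2))" for n
          by (simp only: c_def power_int_minus power_int_of_nat power_mult_distrib divide_inverse
              inverse_mult_distrib mult_ac)
        ultimately show "f (\<zeta> * z)
          = ennreal ((norm (\<Sum>n<N. c n * \<zeta> powi (- int (n + 2))))\<^sup>2) * indicator ?E z"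
          unfolding f_def by (simp add: indicator_def norm_mult)
      qed
    qed
    also have "\<dots> = (\<integral>\<^sup>+\<zeta>. ennreal ((norm (\<Sum>n<N. c n * \<zeta> powi (- int (n + 2))))\<^sup>2) \<partial>circle_measure) * indicator ?E z"
      by (rule nn_integral_multc) measurable
    also have "\<dots> = ennreal (2 * pi * (\<Sum>n<N. (norm (c n))\<^sup>2)) * indicator ?E z"
      by (subst nn_integral_circle_trigonometric_sum) (auto simp: inj_on_def)
    also have "2 * pi * (\<Sum>n<N. (norm (c n))\<^sup>2) = (\<Sum>n<N. 2 * pi * (norm (a n))\<^sup>2 * (1 / norm z ^ (2 * (n + 2))))"
      unfolding c_def sum_distrib_left
      by (intro sum.cong) (simp_all only: norm_divide norm_power power_divide power_mult[symmetric] mult.commute[of 2]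
          mult_1_right times_divide_eq_right)
    also have "ennreal \<dots> = (\<Sum>n<N. ennreal (2 * pi * (norm (a n))\<^sup>2 * (1 / norm z ^ (2 * (n + 2)))))"
      by (intro sum_ennreal[symmetric]) simp
    also have "\<dots> = (\<Sum>n<N. ennreal (2 * pi * (norm (a n))\<^sup>2) * ennreal (1 / norm z ^ (2 * (n + 2))))"
      by (intro sum.cong refl ennreal_mult) auto
    finally show ?thesis by (simp add: sum_distrib_right mult.assoc)
  qed
  have "ennreal (2 * pi) * (\<integral>\<^sup>+z. f z \<partial>lborel) = (\<integral>\<^sup>+z. (\<integral>\<^sup>+\<zeta>. f (\<zeta> * z) \<partial>circle_measure) \<partial>lborel)"
    by (rule nn_integral_circle_average[symmetric]) measurable
  also have "\<dots> = (\<Sum>n<N. ennreal (2 * pi * (norm (a n))\<^sup>2) *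
      (\<integral>\<^sup>+z. ennreal (1 / norm z ^ (2 * (n + 2))) * indicator ?E z \<partial>lborel))"
    unfolding avg by (subst nn_integral_sum) (auto intro!: sum.cong nn_integral_cmult)
  also have "\<dots> = (\<Sum>n<N. ennreal (2 * pi) * ennreal (pi * ((norm (a n))\<^sup>2 / (n + 1))))"
  proof (rule sum.cong[OF refl])
    fix n
    show "ennreal (2 * pi * (norm (a n))\<^sup>2) *
        (\<integral>\<^sup>+z. ennreal (1 / norm z ^ (2 * (n + 2))) * indicator ?E z \<partial>lborel)
      = ennreal (2 * pi) * ennreal (pi * ((norm (a n))\<^sup>2 / (n + 1)))"
      using nn_integral_exterior_norm_power[of "n + 2"]
      by (simp add: ennreal_mult[symmetric] mult_ac)
  qed
  also have "\<dots> = ennreal (2 * pi) * ennreal (pi * (\<Sum>n<N. (norm (a n))\<^sup>2 / (n + 1)))"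
    unfolding sum_distrib_left by (subst sum_distrib_left[symmetric], subst sum_ennreal) auto
  finally show ?thesis
    unfolding f_def by (subst (asm) ennreal_mult_cancel_left) auto
qed

text \<open>Fatou's lemma passes from the partial sums, whose integrals are known exactly, to the
  series; an upper bound is enough for finiteness.\<close>

lemma nn_integral_exterior_laurent_series_le:
  fixes a :: "nat \<Rightarrow> complex"
  assumes sums: "\<And>z. 1 < norm z \<Longrightarrow> (\<lambda>n. a n / z ^ (n + 2)) sums f z"
    and bound: "\<And>N. (\<Sum>n<N. (norm (a n))\<^sup>2 / (n + 1)) \<le> B"
  shows "(\<integral>\<^sup>+z\<in>{z. 1 < norm z}. ennreal ((norm (f z))\<^sup>2) \<partial>lborel) \<le> ennreal (pi * B)"
proof -
  let ?E = "{z::complex. 1 < norm z}"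
  define g where "g N z = ennreal ((norm (\<Sum>n<N. a n / z ^ (n + 2)))\<^sup>2) * indicator ?E z" for N and z :: complex
  have [measurable]: "?E \<in> sets borel" by measurable
  have "(\<integral>\<^sup>+z\<in>?E. ennreal ((norm (f z))\<^sup>2) \<partial>lborel) = (\<integral>\<^sup>+z. liminf (\<lambda>N. g N z) \<partial>lborel)"
  proof (rule nn_integral_cong)
    fix z :: complex
    have "(\<lambda>N. g N z) \<longlonglongrightarrow> ennreal ((norm (f z))\<^sup>2) * indicator ?E z"
    proof (cases "z \<in> ?E")
      case True
      with sums[of z] show ?thesis
        unfolding g_def sums_def by (auto intro!: tendsto_intros tendsto_ennrealI)
    qed (simp add: g_def)
    then show "ennreal ((norm (f z))\<^sup>2) * indicator ?E z = liminf (\<lambda>N. g N z)"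
      by (rule lim_imp_Liminf[OF trivial_limit_sequentially, symmetric])
  qed
  also have "\<dots> \<le> liminf (\<lambda>N. \<integral>\<^sup>+z. g N z \<partial>lborel)"
    by (rule nn_integral_liminf) (simp add: g_def)
  also have "\<dots> \<le> ennreal (pi * B)"
    unfolding g_def nn_integral_exterior_laurent_sum
    using bound by (intro Liminf_le always_eventually allI ennreal_leI mult_left_mono) auto
  finally show ?thesis .
qed

section \<open>Null-controllable states\<close>

text \<open>The weight \<open>exp (n * s)\<close> times the \<open>- n\<close>-th power of the
  angular variable is the \<open>- n\<close>-th power of this point, so one complex variable carries
  both the decay in time and the frequency.\<close>

definition sector_point :: "real \<times> complex \<Rightarrow> complex" where
  "sector_point p = snd p * of_real (exp (- fst p))"

lemma measurable_sector_point [measurable]: "sector_point \<in> borel_measurable time_circle_measure"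
  unfolding sector_point_def[abs_def] by measurable

lemma norm_sector_point: "norm (snd p) = 1 \<Longrightarrow> norm (sector_point p) = exp (- fst p)"
  by (simp add: sector_point_def norm_mult)

text \<open>Duality: \<open>v\<close> is paired with a polynomial \<open>P\<close> in the sector
  point. The sum is finite, so \<open>X\<close> is a real number and half of it can be absorbed at
  the end.\<close>

lemma sector_moments_square_sum_le:
  assumes u: "u \<in> control_L2 \<omega> T" and "0 < T"
  defines "v \<equiv> control_extension \<omega> T u"
  defines "d n \<equiv> LINT p|time_circle_measure. v p * sector_point p ^ Suc n"
  shows "(\<Sum>n<N. Suc n * (norm (d n))\<^sup>2) \<le> pi * (LINT p|time_circle_measure. (norm (v p))\<^sup>2)"
proof -
  note [measurable] = measurable_control_extension[OF u, folded v_def]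
  define X where "X = (\<Sum>n<N. Suc n * (norm (d n))\<^sup>2)"
  define V where "V = (LINT p|time_circle_measure. (norm (v p))\<^sup>2)"
  have X0: "0 \<le> X" and V0: "0 \<le> V"
    by (simp_all add: X_def V_def sum_nonneg)
  \<comment> \<open>The coefficients are chosen so that the integral of \<open>v p * P p\<close> is
    exactly \<open>X\<close>.\<close>
  define P where "P p = (\<Sum>n<N. (Suc n * cnj (d n)) * sector_point p ^ Suc n)" for p
  have [measurable]: "P \<in> borel_measurable time_circle_measure"
    unfolding P_def[abs_def] by measurable
  have int: "integrable time_circle_measure (\<lambda>p. v p * sector_point p ^ Suc n)" for n
    unfolding v_def
  proof (rule integrable_control_extension_mult[OF u])
    fix s and z :: complex assume "s \<in> {0..T}" "norm z = 1"
    then have "norm (sector_point (s, z)) \<le> 1" by (simp add: norm_sector_point)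
    then show "norm (sector_point (s, z) ^ Suc n) \<le> 1"
      unfolding norm_power by (intro power_le_one) auto
  qed measurable
  have vP: "v p * P p = (\<Sum>n<N. (Suc n * cnj (d n)) * (v p * sector_point p ^ Suc n))" for p
    by (simp only: P_def sum_distrib_left mult_ac)
  have int_vP: "integrable time_circle_measure (\<lambda>p. v p * P p)"
    unfolding vP by (intro Bochner_Integration.integrable_sum integrable_mult_right int)
  have "(LINT p|time_circle_measure. v p * P p)
      = (\<Sum>n<N. (LINT p|time_circle_measure. (Suc n * cnj (d n)) * (v p * sector_point p ^ Suc n)))"
    unfolding vP by (intro Bochner_Integration.integral_sum integrable_mult_right int)
  also have "\<dots> = (\<Sum>n<N. (Suc n * cnj (d n)) * d n)"
    unfolding d_def by (simp only: integral_mult_right_zero)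
  also have "\<dots> = of_real X"
    unfolding X_def of_real_sum
    by (intro sum.cong refl) (simp add: complex_norm_square mult_ac del: of_real_power)
  finally have X: "(LINT p|time_circle_measure. v p * P p) = of_real X" .
  \<comment> \<open>The cutoff is invisible next to \<open>v\<close>, which vanishes outside the
    strip, but it is what makes the square integral finite: powers of \<open>exp (- s)\<close> blow
    up for negative times.\<close>
  define Q where "Q p = indicat_real ({0..T} \<times> UNIV) p * norm (P p)" for p
  have [measurable]: "{0..T} \<times> UNIV \<in> sets time_circle_measure"
    by (intro pair_measureI) auto
  have [measurable]: "Q \<in> borel_measurable time_circle_measure"
    unfolding Q_def[abs_def] by measurable
  \<comment> \<open>Parseval in the angle at each fixed time leaves integrals of
    \<open>exp (- (2 * Suc n) * s)\<close> over \<open>{0..T}\<close>, each at most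
    \<open>1 / (2 * Suc n)\<close>. This removes one factor \<open>Suc n\<close> and turns
    \<open>2 * pi\<close> into \<open>pi\<close>.\<close>
  have QI: "(\<integral>\<^sup>+p. ennreal ((Q p)\<^sup>2) \<partial>time_circle_measure) \<le> ennreal (pi * X)"
  proof -
    have "(\<integral>\<^sup>+p. ennreal ((Q p)\<^sup>2) \<partial>time_circle_measure)
        = (\<integral>\<^sup>+s. (\<integral>\<^sup>+z. ennreal ((Q (s, z))\<^sup>2) \<partial>circle_measure) \<partial>lborel)"
      by (rule circle.nn_integral_fst[symmetric]) measurable
    also have "\<dots> = (\<integral>\<^sup>+s. (\<Sum>n<N. ennreal (2 * pi * (Suc n)\<^sup>2 * (norm (d n))\<^sup>2) *
        (ennreal (exp (- (2 * Suc n) * s)) * indicator {0..T} s)) \<partial>lborel)"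
    proof (rule nn_integral_cong)
      fix s :: real
      define c where "c n = (Suc n * cnj (d n)) * of_real (exp (- s)) ^ Suc n" for n
      have P: "P (s, z) = (\<Sum>n<N. c n * z powi int (Suc n))" for z
        unfolding P_def c_def sector_point_def
        by (intro sum.cong refl) (simp only: fst_conv snd_conv power_int_of_nat power_mult_distrib mult_ac)
      have "(\<integral>\<^sup>+z. ennreal ((Q (s, z))\<^sup>2) \<partial>circle_measure)
          = (\<integral>\<^sup>+z. ennreal ((norm (\<Sum>n<N. c n * z powi int (Suc n)))\<^sup>2) * indicator {0..T} s \<partial>circle_measure)"
        unfolding P[symmetric] by (intro nn_integral_cong) (simp add: Q_def indicator_def)
      also have "\<dots> = (\<integral>\<^sup>+z. ennreal ((norm (\<Sum>n<N. c n * z powi int (Suc n)))\<^sup>2) \<partial>circle_measure) * indicator {0..T} s"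
        by (rule nn_integral_multc) measurable
      also have "\<dots> = ennreal (2 * pi * (\<Sum>n<N. (norm (c n))\<^sup>2)) * indicator {0..T} s"
        by (subst nn_integral_circle_trigonometric_sum) (auto simp: inj_on_def)
      also have "2 * pi * (\<Sum>n<N. (norm (c n))\<^sup>2)
          = (\<Sum>n<N. (2 * pi * (Suc n)\<^sup>2 * (norm (d n))\<^sup>2) * exp (- (2 * Suc n) * s))"
        unfolding sum_distrib_left
      proof (rule sum.cong[OF refl])
        fix n
        have "(exp (- s) ^ Suc n)\<^sup>2 = exp (- (2 * Suc n) * s)"
          by (simp only: exp_of_nat_mult[symmetric] power_mult[symmetric]) (simp add: algebra_simps)
        moreover have "norm (c n) = Suc n * norm (d n) * exp (- s) ^ Suc n"
          unfolding c_def norm_mult norm_power norm_of_real norm_of_nat complex_mod_cnj by simp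
        ultimately show "2 * pi * (norm (c n))\<^sup>2 = (2 * pi * (Suc n)\<^sup>2 * (norm (d n))\<^sup>2) * exp (- (2 * Suc n) * s)"
          by (simp only: power_mult_distrib of_nat_power mult_ac)
      qed
      also have "ennreal \<dots> = (\<Sum>n<N. ennreal (2 * pi * (Suc n)\<^sup>2 * (norm (d n))\<^sup>2 * exp (- (2 * Suc n) * s)))"
        by (intro sum_ennreal[symmetric]) simp
      also have "\<dots> = (\<Sum>n<N. ennreal (2 * pi * (Suc n)\<^sup>2 * (norm (d n))\<^sup>2) * ennreal (exp (- (2 * Suc n) * s)))"
        by (intro sum.cong refl ennreal_mult) auto
      finally show "(\<integral>\<^sup>+z. ennreal ((Q (s, z))\<^sup>2) \<partial>circle_measure)
          = (\<Sum>n<N. ennreal (2 * pi * (Suc n)\<^sup>2 * (norm (d n))\<^sup>2) *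
              (ennreal (exp (- (2 * Suc n) * s)) * indicator {0..T} s))"
        by (simp only: sum_distrib_right mult.assoc)
    qed
    also have "\<dots> = (\<Sum>n<N. ennreal (2 * pi * (Suc n)\<^sup>2 * (norm (d n))\<^sup>2) *
        (\<integral>\<^sup>+s. ennreal (exp (- (2 * Suc n) * s)) * indicator {0..T} s \<partial>lborel))"
      by (subst nn_integral_sum) (auto intro!: sum.cong nn_integral_cmult)
    also have "\<dots> \<le> (\<Sum>n<N. ennreal (2 * pi * (Suc n)\<^sup>2 * (norm (d n))\<^sup>2) * ennreal (1 / (2 * Suc n)))"
    proof (intro sum_mono mult_left_mono)
      fix n
      let ?m = "2 * real (Suc n)"
      have "(\<integral>\<^sup>+s. ennreal (exp (- ?m * s)) * indicator {0..T} s \<partial>lborel)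
          = ennreal (- exp (- ?m * T) / ?m - (- exp (- ?m * 0) / ?m))"
      proof (rule nn_integral_FTC_Icc[where F = "\<lambda>s. - exp (- ?m * s) / ?m"])
        fix s
        have "((\<lambda>s. - exp (- ?m * s) / ?m) has_real_derivative (- (exp (- ?m * s) * - ?m) / ?m)) (at s)"
          by (rule derivative_eq_intros refl | simp)+
        moreover have "- (exp (- ?m * s) * - ?m) / ?m = exp (- ?m * s)"
          using nonzero_mult_div_cancel_right[of ?m "exp (- ?m * s)"]
          by (simp only: mult_minus_right minus_minus mult_eq_0_iff of_nat_eq_0_iff) simp
        ultimately show "((\<lambda>s. - exp (- ?m * s) / ?m) has_real_derivative exp (- ?m * s)) (at s)"
          by (simp only:)
      qed (use \<open>0 < T\<close> in auto)
      also have "\<dots> \<le> ennreal (1 / ?m)"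
        by (intro ennreal_leI) simp
      finally show "(\<integral>\<^sup>+s. ennreal (exp (- (2 * Suc n) * s)) * indicator {0..T} s \<partial>lborel) \<le> ennreal (1 / (2 * Suc n))"
        by simp
    qed simp
    also have "\<dots> = (\<Sum>n<N. ennreal (pi * (Suc n * (norm (d n))\<^sup>2)))"
    proof (rule sum.cong[OF refl])
      fix n
      have "2 * pi * m\<^sup>2 * (norm (d n))\<^sup>2 * (1 / (2 * m)) = pi * (m * (norm (d n))\<^sup>2)" for m :: real
        by (simp add: power2_eq_square)
      from this[of "Suc n"] show "ennreal (2 * pi * (Suc n)\<^sup>2 * (norm (d n))\<^sup>2) * ennreal (1 / (2 * Suc n))
          = ennreal (pi * (Suc n * (norm (d n))\<^sup>2))"
        by (subst ennreal_mult[symmetric]) simp_all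
    qed
    also have "\<dots> = ennreal (pi * X)"
      unfolding X_def sum_distrib_left by (intro sum_ennreal) simp
    finally show ?thesis .
  qed
  have "ennreal X = ennreal (norm (LINT p|time_circle_measure. v p * P p))"
    using X0 by (simp add: X)
  also have "\<dots> \<le> (\<integral>\<^sup>+p. ennreal (norm (v p * P p)) \<partial>time_circle_measure)"
    by (rule integral_norm_bound_ennreal[OF int_vP])
  also have "\<dots> \<le> (\<integral>\<^sup>+p. ennreal (pi / 2) * ennreal ((norm (v p))\<^sup>2) + ennreal (1 / (2 * pi)) * ennreal ((Q p)\<^sup>2) \<partial>time_circle_measure)"
  proof (rule nn_integral_mono)
    fix p
    have "norm (v p * P p) = norm (v p) * Q p"
      using control_extension_eq_0[of p T \<omega> u]
      by (cases "p \<in> {0..T} \<times> UNIV") (auto simp: Q_def v_def norm_mult)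
    \<comment> \<open>The weights are chosen so that \<open>QI\<close> turns the second term into \<open>X / 2\<close>, absorbed by the left-hand side.\<close>
    also have "\<dots> \<le> pi / 2 * (norm (v p))\<^sup>2 + 1 / (2 * pi) * (Q p)\<^sup>2"
    proof -
      have "0 \<le> (pi * norm (v p) - Q p)\<^sup>2 / (2 * pi)" by simp
      also have "\<dots> = pi / 2 * (norm (v p))\<^sup>2 + 1 / (2 * pi) * (Q p)\<^sup>2 - norm (v p) * Q p"
        by (simp add: power2_eq_square field_simps)
      finally show ?thesis by simp
    qed
    finally have "ennreal (norm (v p * P p)) \<le> ennreal (pi / 2 * (norm (v p))\<^sup>2 + 1 / (2 * pi) * (Q p)\<^sup>2)"
      by (rule ennreal_leI)
    also have "\<dots> = ennreal (pi / 2) * ennreal ((norm (v p))\<^sup>2) + ennreal (1 / (2 * pi)) * ennreal ((Q p)\<^sup>2)"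
      by (simp add: ennreal_mult[symmetric] ennreal_plus[symmetric] del: ennreal_plus)
    finally show "ennreal (norm (v p * P p))
        \<le> ennreal (pi / 2) * ennreal ((norm (v p))\<^sup>2) + ennreal (1 / (2 * pi)) * ennreal ((Q p)\<^sup>2)" .
  qed
  also have "\<dots> = ennreal (pi / 2) * (\<integral>\<^sup>+p. ennreal ((norm (v p))\<^sup>2) \<partial>time_circle_measure)
      + ennreal (1 / (2 * pi)) * (\<integral>\<^sup>+p. ennreal ((Q p)\<^sup>2) \<partial>time_circle_measure)"
    by (subst nn_integral_add) (auto simp: nn_integral_cmult)
  also have "(\<integral>\<^sup>+p. ennreal ((norm (v p))\<^sup>2) \<partial>time_circle_measure) = ennreal V"
    unfolding V_def v_def
    by (intro nn_integral_eq_integral integrable_control_extension_norm_square[OF u]) simp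
  also have "ennreal (pi / 2) * ennreal V + ennreal (1 / (2 * pi)) * (\<integral>\<^sup>+p. ennreal ((Q p)\<^sup>2) \<partial>time_circle_measure)
      \<le> ennreal (pi / 2) * ennreal V + ennreal (1 / (2 * pi)) * ennreal (pi * X)"
    by (intro add_left_mono mult_left_mono QI) simp
  also have "\<dots> = ennreal (pi / 2 * V + X / 2)"
    using X0 V0 by (simp add: ennreal_mult[symmetric] ennreal_plus[symmetric] del: ennreal_plus)
  finally have "X \<le> pi / 2 * V + X / 2"
    using X0 V0 by (subst (asm) ennreal_le_iff) auto
  then show ?thesis by (simp add: X_def V_def)
qed

section \<open>Geometry of the sector and continuation of the Hardy function\<close>

lemma hardy_function_sums:
  assumes "norm z < 1"
  shows "(\<lambda>n. fourier_coeff f (int n) * z ^ n) sums hardy_function f z"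
proof -
  have "summable (\<lambda>n. norm f * norm z ^ n)"
    using assms by (intro summable_mult summable_geometric) simp
  then have "summable (\<lambda>n. fourier_coeff f (int n) * z ^ n)"
    by (rule summable_comparison_test'[where N = 0])
      (auto simp: norm_mult norm_power intro!: mult_right_mono norm_fourier_coeff_le)
  then show ?thesis unfolding hardy_function_def by (rule summable_sums)
qed

lemma hardy_function_holomorphic: "hardy_function f holomorphic_on ball 0 1"
  by (rule power_series_holomorphic) (use hardy_function_sums in simp)

text \<open>For \<open>A\<close> on the unit circle this is a polar rectangle, with radii from
  \<open>exp (- T)\<close> to \<open>1\<close>, so it keeps away from the origin.\<close>

definition closed_sector :: "complex set \<Rightarrow> real \<Rightarrow> complex set" where
  "closed_sector A T = sector_point ` ({0..T} \<times> A)"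

lemma closed_closed_sector:
  assumes "compact A"
  shows "closed (closed_sector A T)"
proof -
  have "continuous_on ({0..T} \<times> A) sector_point"
    unfolding sector_point_def[abs_def] by (intro continuous_intros)
  then have "compact (closed_sector A T)"
    unfolding closed_sector_def using assms by (intro compact_continuous_image compact_Times) auto
  then show ?thesis by (rule compact_imp_closed)
qed

text \<open>The third fact is what finally reduces the excluded set to the arc: the sector touches
  the unit circle only at time \<open>0\<close>, that is, inside \<open>A\<close>.\<close>

lemma norm_closed_sector:
  assumes "A \<subseteq> sphere 0 1" "z \<in> closed_sector A T"
  shows "exp (- T) \<le> norm z" "norm z \<le> 1" "norm z = 1 \<Longrightarrow> z \<in> A"
proof -
  obtain s \<zeta> where s: "s \<in> {0..T}" "\<zeta> \<in> A" "z = sector_point (s, \<zeta>)"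
    using assms(2) by (auto simp: closed_sector_def)
  then have n: "norm z = exp (- s)" using assms(1) norm_sector_point[of "(s, \<zeta>)"] by auto
  then show "exp (- T) \<le> norm z" "norm z \<le> 1" using s by auto
  show "z \<in> A" if "norm z = 1"
    using that n s by (simp add: sector_point_def)
qed

text \<open>Moving outward along a ray lowers the time parameter and keeps the angle, so a point of
  the disk lies in the sector as soon as a point between it and \<open>0\<close> does. The
  complement is therefore starlike about \<open>0\<close>.\<close>

lemma connected_ball_minus_closed_sector:
  assumes A: "A \<subseteq> sphere 0 1"
  shows "connected (ball 0 1 - closed_sector A T)"
proof (rule starlike_imp_connected)
  show "starlike (ball 0 1 - closed_sector A T)"
    unfolding starlike_def
  proof (intro bexI ballI)
    show "0 \<in> ball 0 1 - closed_sector A T"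
      using norm_closed_sector(1)[OF A, of 0 T] by auto
    fix x assume x: "x \<in> ball 0 1 - closed_sector A T"
    show "closed_segment 0 x \<subseteq> ball 0 1 - closed_sector A T"
    proof
      fix y assume "y \<in> closed_segment 0 x"
      then obtain t where t: "0 \<le> t" "t \<le> 1" "y = t *\<^sub>R x"
        by (auto simp: in_segment)
      have "norm y \<le> norm x" using t by (simp add: mult_left_le_one_le)
      then have "y \<in> ball 0 1" using x by simp
      moreover have "y \<notin> closed_sector A T"
      proof
        assume y: "y \<in> closed_sector A T"
        then obtain s \<zeta> where s: "s \<in> {0..T}" "\<zeta> \<in> A" "y = sector_point (s, \<zeta>)"
          by (auto simp: closed_sector_def)
        have "y \<noteq> 0" using norm_closed_sector(1)[OF A y] by auto
        then have t0: "0 < t" and x0: "x \<noteq> 0" using t by auto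
        \<comment> \<open>\<open>r\<close> is the time at which the ray through
          \<open>\<zeta>\<close> passes \<open>x\<close>: it is nonnegative since \<open>x\<close>
          is in the disk, and at most \<open>s\<close> since \<open>y\<close> is no farther out than
          \<open>x\<close>.\<close>
        define r where "r = - ln (norm x)"
        have r: "norm x = exp (- r)" using x0 by (simp add: r_def)
        have \<zeta>: "norm \<zeta> = 1" using A s by auto
        have ny: "exp (- s) = t * exp (- r)"
          using norm_sector_point[of "(s, \<zeta>)"] \<zeta> s(3)[symmetric] t(1,3) r by simp
        then have "exp (- s) \<le> exp (- r)" using t by (simp add: mult_left_le_one_le)
        then have "r \<le> T" using s by simp
        moreover have "0 \<le> r" using x r by (simp add: less_imp_le)
        moreover have "x = sector_point (r, \<zeta>)"
        proof -
          have "of_real t * x = of_real t * sector_point (r, \<zeta>)"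
            using s(3) t(3) ny by (simp add: sector_point_def scaleR_conv_of_real mult_ac)
          then show ?thesis using t0 by simp
        qed
        ultimately have "x \<in> closed_sector A T" using s by (auto simp: closed_sector_def)
        with x show False by simp
      qed
      ultimately show "y \<in> ball 0 1 - closed_sector A T" by simp
    qed
  qed
qed

text \<open>Here the coefficients are assumed to be moments of the control; the theorem treats the
  case of vanishing coefficients separately.\<close>

lemma cauchy_transform_extension:
  assumes \<omega>: "closure \<omega> \<subseteq> sphere 0 1" and T: "0 < T" and u: "u \<in> control_L2 \<omega> T"
    and coeff: "\<And>n. fourier_coeff f (int n) = - 1 / (2 * pi) *
      (LINT p|time_circle_measure. control_extension \<omega> T u p * (of_real (exp (n * fst p)) * snd p powi (- int n)))"
  shows "\<exists>F :: riemann_sphere \<Rightarrow> complex.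
    sphere_holomorphic_on F (- (Point ` closure \<omega>)) \<and>
    (\<forall>z \<in> ball 0 1. F (Point z) = hardy_function f z) \<and>
    F Infinity = 0 \<and>
    (\<integral>\<^sup>+ z \<in> {z. 1 < norm z}. ennreal ((norm (deriv (\<lambda>z. F (Point z)) z))\<^sup>2) \<partial>lborel) < \<infinity>"
proof -
  define v where "v = control_extension \<omega> T u"
  note [measurable] = measurable_control_extension[OF u, folded v_def]
  let ?M = "time_circle_measure" and ?q = sector_point
  \<comment> \<open>The factor \<open>?q p\<close> offsets the shift in the Cauchy kernel: the
    \<open>n\<close>-th coefficient at \<open>0\<close> is the integral of
    \<open>g p / ?q p ^ Suc n\<close>, which up to the constant is that of
    \<open>v p / ?q p ^ n\<close>.\<close>
  define g where "g p = - 1 / (2 * pi) * (v p * ?q p)" for p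
  define g' where "g' p = g p / ?q p" for p
  define q' where "q' p = 1 / ?q p" for p
  define K where "K = closed_sector (closure \<omega>) T"
  have compact: "compact (closure \<omega>)"
    using \<omega> by (meson bounded_sphere bounded_subset closed_closure compact_eq_bounded_closed)
  have K: "closed K" "\<And>z. z \<in> K \<Longrightarrow> exp (- T) \<le> norm z" "\<And>z. z \<in> K \<Longrightarrow> norm z \<le> 1"
    "\<And>z. z \<in> K \<Longrightarrow> norm z = 1 \<Longrightarrow> z \<in> closure \<omega>"
    using closed_closed_sector[OF compact] norm_closed_sector[OF \<omega>] by (auto simp: K_def)
  have [measurable]: "g \<in> borel_measurable ?M" "g' \<in> borel_measurable ?M" "q' \<in> borel_measurable ?M"
    unfolding g_def[abs_def] g'_def[abs_def] q'_def[abs_def] by measurable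
  have v0: "p \<in> {0..T} \<times> \<omega>" if "v p \<noteq> 0" for p
    using that control_extension_eq_0[of p T \<omega> u] by (auto simp: v_def)
  have gK: "?q p \<in> K" if "g p \<noteq> 0" for p
    using v0[of p] that closure_subset[of \<omega>] by (auto simp: g_def K_def closed_sector_def)
  have q0: "?q p \<noteq> 0" if "v p \<noteq> 0" for p
  proof -
    have "norm (snd p) = 1" using v0[OF that] \<omega> closure_subset[of \<omega>] by auto
    then show ?thesis by (auto simp: sector_point_def)
  qed
  have int_g: "integrable ?M g"
  proof -
    have "integrable ?M (\<lambda>p. v p * ?q p)"
      unfolding v_def by (intro integrable_control_extension_mult[OF u, where B = 1]) (auto simp: norm_sector_point)
    then show ?thesis unfolding g_def[abs_def] by (rule integrable_mult_right)
  qed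
  have g'_eq: "g' = (\<lambda>p. - 1 / (2 * pi) * v p)"
  proof
    show "g' p = - 1 / (2 * pi) * v p" for p
      using q0[of p] by (cases "v p = 0") (auto simp: g'_def g_def)
  qed
  have int_g': "integrable ?M g'"
    unfolding g'_eq v_def by (intro integrable_mult_right integrable_control_extension u)
  define C where "C = cauchy_transform ?M g ?q"
  define C' where "C' = cauchy_transform ?M g' q'"
  have C_hol: "C holomorphic_on - K"
    unfolding C_def by (rule holomorphic_on_cauchy_transform[OF int_g _ K(1) gK]) measurable
  have C_hardy: "C z = hardy_function f z" if "z \<in> ball 0 1 - K" for z
  proof -
    \<comment> \<open>All poles have norm at least \<open>exp (- T)\<close>, so on this ball the
      expansion about \<open>0\<close> converges, and its coefficients are those of
      \<open>f\<close>.\<close>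
    have eq: "hardy_function f z = C z" if z: "z \<in> ball 0 (exp (- T))" for z
    proof -
      have "(\<lambda>n. (LINT p|?M. g p / (?q p - 0) ^ Suc n) * (z - 0) ^ n) sums C z"
        unfolding C_def
        by (rule cauchy_transform_sums[OF int_g, where \<delta> = "exp (- T)"]) (use z K(2) gK in auto)
      moreover have "(LINT p|?M. g p / (?q p - 0) ^ Suc n) = fourier_coeff f (int n)" for n
      proof -
        have "g p / (?q p - 0) ^ Suc n = - 1 / (2 * pi) * (v p * (of_real (exp (n * fst p)) * snd p powi (- int n)))"
          for p :: "real \<times> complex"
        proof (cases "v p = 0")
          case False
          then have "g p / (?q p - 0) ^ Suc n = - 1 / (2 * pi) * (v p / ?q p ^ n)"
            using q0 by (simp add: g_def)
          also have "v p / ?q p ^ n = v p * (of_real (exp (n * fst p)) * snd p powi (- int n))"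
            by (simp add: sector_point_def power_mult_distrib power_int_minus exp_minus exp_of_nat_mult
                power_inverse divide_inverse mult_ac)
          finally show ?thesis .
        qed (simp add: g_def)
        then show ?thesis by (simp only: integral_mult_right_zero coeff v_def)
      qed
      ultimately have "(\<lambda>n. fourier_coeff f (int n) * z ^ n) sums C z" by simp
      moreover have "norm z < 1" using z T less_trans[of "norm z" "exp (- T)" 1] by simp
      ultimately show ?thesis using hardy_function_sums sums_unique2 by blast
    qed
    have "hardy_function f z = C z"
    proof (rule analytic_continuation_open[where s = "ball 0 (exp (- T))" and s' = "ball 0 1 - K"
          and f = "hardy_function f" and g = C])
      show "ball 0 (exp (- T)) \<subseteq> ball 0 1 - K" using T K(2) less_trans[of _ "exp (- T)" 1] by fastforce
      show "connected (ball 0 1 - K)"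
        unfolding K_def by (rule connected_ball_minus_closed_sector[OF \<omega>])
      show "hardy_function f holomorphic_on ball 0 1 - K"
        using hardy_function_holomorphic by (rule holomorphic_on_subset) auto
      show "C holomorphic_on ball 0 1 - K" using C_hol by (rule holomorphic_on_subset) auto
    qed (use eq that K(1) in auto)
    then show ?thesis by simp
  qed
  \<comment> \<open>Inversion sends the sector outside the open unit disk, so the transform in the
    coordinate \<open>1 / z\<close> is holomorphic on that disk.\<close>
  have q'_ge: "1 \<le> norm (q' p)" if "g' p \<noteq> 0" for p
  proof -
    have "v p \<noteq> 0" using that by (simp add: g'_eq)
    moreover from this have "g p \<noteq> 0" using q0 by (simp add: g_def)
    ultimately show ?thesis using K(3)[OF gK] q0 by (simp add: q'_def norm_divide)
  qed
  have C'_hol: "C' holomorphic_on ball 0 1"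
  proof -
    have "C' holomorphic_on - {w. 1 \<le> norm w}"
      unfolding C'_def by (rule holomorphic_on_cauchy_transform[OF int_g'])
        (use q'_ge in \<open>auto intro!: closed_Collect_le continuous_intros\<close>)
    then show ?thesis by (rule holomorphic_on_subset) auto
  qed
  have C_inv: "C z = - (1 / z) * C' (1 / z)" if "z \<noteq> 0" for z
    unfolding C_def C'_def g'_def[abs_def] q'_def[abs_def]
    using that q0 by (intro cauchy_transform_inversion) (auto simp: g_def)
  \<comment> \<open>Inside the disk the Hardy function also covers the sector, where
    \<open>C\<close> need not be holomorphic. The two agree on the disk off \<open>K\<close>, so the
    gluing loses only the arc.\<close>
  define F where "F P = (case P of Infinity \<Rightarrow> 0 | Point z \<Rightarrow> if norm z < 1 then hardy_function f z else C z)" for P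
  have F_C: "F (Point z) = C z" if "z \<notin> K" for z
    using C_hardy[of z] that by (simp add: F_def)
  have F_hol: "(\<lambda>z. F (Point z)) holomorphic_on - closure \<omega>"
  proof -
    have "(\<lambda>z. F (Point z)) holomorphic_on ball 0 1 \<union> - K"
    proof (rule holomorphic_on_Un)
      show "(\<lambda>z. F (Point z)) holomorphic_on ball 0 1"
        by (rule holomorphic_transform[OF hardy_function_holomorphic]) (simp add: F_def)
      show "(\<lambda>z. F (Point z)) holomorphic_on - K"
        by (rule holomorphic_transform[OF C_hol]) (simp add: F_C)
    qed (use K(1) in auto)
    then show ?thesis
    proof (rule holomorphic_on_subset)
      \<comment> \<open>A point in neither open set belongs to \<open>K\<close> and has norm
        \<open>1\<close>, hence lies on the closed arc.\<close>
      show "- closure \<omega> \<subseteq> ball 0 1 \<union> - K"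
        using K(3,4) by (force simp: not_less)
    qed
  qed
  have "sphere_holomorphic_on F (- (Point ` closure \<omega>))"
    unfolding sphere_holomorphic_on_def
  proof
    have "Point -` (- (Point ` closure \<omega>)) = - closure \<omega>" by auto
    then show "(\<lambda>z. F (Point z)) holomorphic_on Point -` (- (Point ` closure \<omega>))"
      using F_hol by simp
    \<comment> \<open>In the chart at infinity the domain is covered by the unit ball, where
      \<open>F\<close> is \<open>- w * C' w\<close> including the value \<open>0\<close> at
      \<open>w = 0\<close>, and by the punctured set \<open>W\<close>, where \<open>F\<close> is the
      plane function composed with inversion.\<close>
    define W where "W = {w. w \<noteq> 0 \<and> 1 / w \<notin> closure \<omega>}"
    have "W = - {0} \<inter> (\<lambda>w. 1 / w) -` (- closure \<omega>)" by (auto simp: W_def)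
    also have "open \<dots>" by (intro continuous_open_preimage continuous_intros) auto
    finally have "open W" .
    have "(\<lambda>w. F (chart_at_infinity w)) holomorphic_on ball 0 1 \<union> W"
    proof (rule holomorphic_on_Un)
      have "(\<lambda>w. - w * C' w) holomorphic_on ball 0 1"
        using C'_hol by (intro holomorphic_intros)
      then show "(\<lambda>w. F (chart_at_infinity w)) holomorphic_on ball 0 1"
      proof (rule holomorphic_transform)
        fix w :: complex assume w: "w \<in> ball 0 1"
        show "- w * C' w = F (chart_at_infinity w)"
        proof (cases "w = 0")
          case False
          then have "1 / w \<notin> K" using w K(3)[of "1 / w"] by (auto simp: norm_divide field_simps)
          then show ?thesis using False C_inv[of "1 / w"] by (simp add: F_C chart_at_infinity_def)
        qed (simp add: F_def chart_at_infinity_def)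
      qed
      have "(\<lambda>z. F (Point z)) \<circ> (\<lambda>w. 1 / w) holomorphic_on W"
        by (rule holomorphic_on_compose_gen[OF _ F_hol])
          (auto simp: W_def intro!: holomorphic_intros)
      then show "(\<lambda>w. F (chart_at_infinity w)) holomorphic_on W"
        by (rule holomorphic_transform) (auto simp: W_def chart_at_infinity_def)
    qed (use \<open>open W\<close> in auto)
    then show "(\<lambda>w. F (chart_at_infinity w)) holomorphic_on chart_at_infinity -` (- (Point ` closure \<omega>))"
      by (rule holomorphic_on_subset) (auto simp: W_def chart_at_infinity_def split: if_splits)
  qed
  moreover have "(\<integral>\<^sup>+ z \<in> {z. 1 < norm z}. ennreal ((norm (deriv (\<lambda>z. F (Point z)) z))\<^sup>2) \<partial>lborel) < \<infinity>"
  proof -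
    define d where "d n = (LINT p|?M. g p * ?q p ^ n)" for n
    \<comment> \<open>Outside the disk \<open>F\<close> has the Laurent terms
      \<open>- d n / z ^ (n + 1)\<close>, whose derivatives are
      \<open>a n / z ^ (n + 2)\<close>.\<close>
    define a where "a n = of_nat (Suc n) * d n" for n
    define V where "V = (LINT p|?M. (norm (v p))\<^sup>2)"
    have C'_sums: "(\<lambda>n. d n * w ^ n) sums C' w" if "norm w < 1" for w
    proof -
      have "(\<lambda>n. (LINT p|?M. g' p / (q' p - 0) ^ Suc n) * (w - 0) ^ n) sums C' w"
        unfolding C'_def by (rule cauchy_transform_sums[OF int_g', where \<delta> = 1]) (use that q'_ge in auto)
      moreover have "g' p / (q' p - 0) ^ Suc n = g p * ?q p ^ n" for p n
        using q0[of p] by (cases "v p = 0") (auto simp: g'_def q'_def g_def power_divide)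
      ultimately show ?thesis by (simp add: d_def)
    qed
    have "(\<lambda>n. a n / z ^ (n + 2)) sums deriv (\<lambda>z. F (Point z)) z" if z: "1 < norm z" for z
    proof -
      have z0: "z \<noteq> 0" using z by auto
      \<comment> \<open>The factor \<open>- w\<close> in \<open>H\<close> shifts the coefficients of
        \<open>C'\<close> up by one index and changes their sign.\<close>
      define c where "c n = (case n of 0 \<Rightarrow> 0 | Suc m \<Rightarrow> - d m)" for n
      define H where "H w = - w * C' w" for w
      have H_sums: "(\<lambda>n. c n * w ^ n) sums H w" if "norm w < 1" for w
      proof -
        have "(\<lambda>n. - w * (d n * w ^ n)) sums H w"
          unfolding H_def by (intro sums_mult C'_sums that)
        then have "(\<lambda>n. c (Suc n) * w ^ Suc n) sums H w"
          by (simp add: c_def mult_ac)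
        from sums_Suc[OF this] show ?thesis by (simp add: c_def)
      qed
      have w: "norm (1 / z) < 1" using z by (simp add: norm_divide divide_less_eq)
      have "H holomorphic_on ball 0 1"
        unfolding H_def[abs_def] using C'_hol by (intro holomorphic_intros)
      then have H': "(H has_field_derivative deriv H (1 / z)) (at (1 / z))"
        using w by (intro holomorphic_derivI[OF _ open_ball]) auto
      have "(\<lambda>n. diffs c n * (1 / z) ^ n) sums deriv H (1 / z)"
        by (rule termdiffs_sums_strong[OF H_sums H' w])
      then have "(\<lambda>n. (- 1 / z\<^sup>2) * (diffs c n * (1 / z) ^ n)) sums ((- 1 / z\<^sup>2) * deriv H (1 / z))"
        by (rule sums_mult)
      moreover have "(- 1 / z\<^sup>2) * (diffs c n * (1 / z) ^ n) = a n / z ^ (n + 2)" for n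
        using z0 by (simp add: diffs_def c_def a_def power_divide power_add power2_eq_square)
      moreover have "deriv (\<lambda>z. F (Point z)) z = (- 1 / z\<^sup>2) * deriv H (1 / z)"
      proof (rule DERIV_imp_deriv)
        have "((\<lambda>z. H (1 / z)) has_field_derivative deriv H (1 / z) * (- 1 / z\<^sup>2)) (at z)"
          by (rule DERIV_chain2[where f = H and g = "\<lambda>z. 1 / z", OF H']) (use z0 in \<open>auto intro!: derivative_eq_intros simp: power2_eq_square\<close>)
        then show "((\<lambda>z. F (Point z)) has_field_derivative (- 1 / z\<^sup>2) * deriv H (1 / z)) (at z)"
          unfolding mult.commute[of "deriv H (1 / z)"]
        proof (rule has_field_derivative_transform_within_open)
          show "open {z::complex. 1 < norm z}" by (intro open_Collect_less continuous_intros)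
          fix x :: complex assume x: "x \<in> {z. 1 < norm z}"
          then have "x \<notin> K" "x \<noteq> 0" using K(3)[of x] by auto
          then show "H (1 / x) = F (Point x)" using C_inv[of x] by (simp add: F_C H_def)
        qed (use z in simp)
      qed
      ultimately show ?thesis by simp
    qed
    \<comment> \<open>As \<open>d n\<close> is \<open>- 1 / (2 * pi)\<close> times the moment
      \<open>e n\<close>, the sum is \<open>1 / (4 * pi\<^sup>2)\<close> times the one in
      \<open>sector_moments_square_sum_le\<close>, which is at most \<open>pi * V\<close>.\<close>
    moreover have "(\<Sum>n<N. (norm (a n))\<^sup>2 / (n + 1)) \<le> V / (4 * pi)" for N
    proof -
      define e where "e n = (LINT p|?M. v p * ?q p ^ Suc n)" for n
      have d_e: "d n = - 1 / (2 * pi) * e n" for n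
      proof -
        have "g p * ?q p ^ n = - 1 / (2 * pi) * (v p * ?q p ^ Suc n)" for p
          by (simp add: g_def mult_ac)
        then show ?thesis unfolding d_def e_def by (simp only: integral_mult_right_zero)
      qed
      have "(\<Sum>n<N. (norm (a n))\<^sup>2 / (n + 1)) = (\<Sum>n<N. 1 / (4 * pi\<^sup>2) * (Suc n * (norm (e n))\<^sup>2))"
      proof (rule sum.cong[OF refl])
        fix n
        have "norm (a n) = Suc n * (norm (e n) / (2 * pi))"
          by (simp add: a_def d_e norm_mult norm_divide del: of_nat_Suc)
        moreover have "(m * (x / (2 * pi)))\<^sup>2 / m = 1 / (4 * pi\<^sup>2) * (m * x\<^sup>2)" for m x :: real
          by (cases "m = 0") (simp_all add: power2_eq_square)
        ultimately show "(norm (a n))\<^sup>2 / (n + 1) = 1 / (4 * pi\<^sup>2) * (Suc n * (norm (e n))\<^sup>2)"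
          by (simp only: Suc_eq_plus1[symmetric] of_nat_Suc[symmetric] add.commute[of _ 1])
      qed
      also have "\<dots> = 1 / (4 * pi\<^sup>2) * (\<Sum>n<N. Suc n * (norm (e n))\<^sup>2)"
        by (rule sum_distrib_left[symmetric])
      also have "\<dots> \<le> 1 / (4 * pi\<^sup>2) * (pi * V)"
        using sector_moments_square_sum_le[OF u T, of N] unfolding e_def V_def v_def
        by (intro mult_left_mono) auto
      also have "\<dots> = V / (4 * pi)" by (simp add: power2_eq_square)
      finally show ?thesis .
    qed
    ultimately have "(\<integral>\<^sup>+ z \<in> {z. 1 < norm z}. ennreal ((norm (deriv (\<lambda>z. F (Point z)) z))\<^sup>2) \<partial>lborel)
        \<le> ennreal (pi * (V / (4 * pi)))"
      by (rule nn_integral_exterior_laurent_series_le)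
    also have "\<dots> < \<infinity>" by simp
    finally show ?thesis .
  qed
  ultimately show ?thesis
    by (intro exI[of _ F]) (simp add: F_def)
qed

theorem theorem1p4:
  fixes \<omega> :: "complex set" and T :: real and f\<^sub>0 :: circle_L2
  assumes "open_strict_interval \<omega>"
    and "0 < T"
    and "f\<^sub>0 \<in> null_controllable_H2 \<omega> T"
  shows "\<exists>F :: riemann_sphere \<Rightarrow> complex.
    sphere_holomorphic_on F (- (Point ` closure \<omega>)) \<and>
    (\<forall>z \<in> ball 0 1. F (Point z) = hardy_function f\<^sub>0 z) \<and>
    F Infinity = 0 \<and>
    (\<integral>\<^sup>+ z \<in> {z. 1 < norm z}. ennreal ((norm (deriv (\<lambda>z. F (Point z)) z))\<^sup>2) \<partial>lborel) < \<infinity>"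
proof -
  obtain u where u: "u \<in> control_L2 \<omega> T" "final_state \<omega> T f\<^sub>0 u = 0"
    using assms(3) by (auto simp: null_controllable_H2_def)
  have "\<omega> \<subseteq> sphere 0 1"
    using assms(1) by (auto simp: open_strict_interval_def)
  then have \<omega>: "closure \<omega> \<subseteq> sphere 0 1"
    by (rule closure_minimal) simp
  from final_state_eq_0_imp_fourier_coeff[OF assms(2) u] show ?thesis
  proof
    \<comment> \<open>Only nonnegative frequencies enter the Hardy function, so it vanishes and is
      extended by \<open>0\<close>.\<close>
    assume "\<forall>n::nat. fourier_coeff f\<^sub>0 (int n) = 0"
    then have "hardy_function f\<^sub>0 = (\<lambda>_. 0)"
      by (simp add: hardy_function_def fun_eq_iff)
    then show ?thesis
      by (intro exI[of _ "\<lambda>_. 0"]) (simp add: sphere_holomorphic_on_def)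
  next
    assume "\<forall>n::nat. fourier_coeff f\<^sub>0 (int n) = - 1 / (2 * pi) *
      (LINT p|time_circle_measure. control_extension \<omega> T u p * (of_real (exp (n * fst p)) * snd p powi (- int n)))"
    with cauchy_transform_extension[OF \<omega> assms(2) u(1)] show ?thesis by blast
  qed
qed

end
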